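(* Let $k$ be a field of characteristic $p>0$, $R$ a standard graded $k$-algebra of Krull dimension $d\ge 1$, $I\subseteq R$ a homogeneous ideal of finite co-length, and $M$ a finitely generated $\mathbb{N}$-graded $R$-module. Let $g$ be the Hilbert-Kunz density function associated to the triple $(M,R,I)$. Then the holomorphic Fourier transform of $g$ is the Frobenius-Poincaré function $F(M,R,I,d)$; that is, for every $y\in\mathbb{C}$, $$\int_{\mathbb{R}}g(x)e^{-iyx}\,dx=F(M,R,I,d)(y).$$
   Context: Standard graded means $\mathbb{N}$-graded with $R_0=k$ and generated over $k$ by finitely many elements of degree one. $I$ has finite co-length if $R/I$ has finite length. $I^{[p^n]}$ is the ideal generated by $p^n$-th powers of elements of $I$; $\lambda$ is length over $k$; $(\cdot)_j$ is the degree $j$ piece; $i$ is a fixed square root of $-1$. Define $g_n:\mathbb{R}\to\mathbb{R}$ by $g_n(x)=\left(\frac{1}{p^n}\right)^{d-1}\lambda\left(\left(\frac{M}{I^{[p^n]}M}\right)_{\lfloor xp^n\rfloor}\right)$. It is known (Trivedi) that there is a compact subset of the non-negative real line containing the supports of all $g_n$ and that $(g_n)_n$ converges pointwise to a compactly supported function $g$, called the Hilbert-Kunz density function of $(M,R,I)$. The holomorphic Fourier transform of a compactly supported Lebesgue integrable function $h$ on $\mathbb{R}$ is $\hat h(y)=\int_{\mathbb{R}}h(x)e^{-iyx}dx$, $y\in\mathbb{C}$ (Lebesgue integral). Finally $$F(M,R,I,d)(y)=\lim_{n\to\infty}\left(\frac{1}{p^n}\right)^{d}\sum_{j\in\mathbb{Z}}\lambda\left(\left(\frac{M}{I^{[p^n]}M}\right)_j\right)e^{-iyj/p^n},$$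 where the limit exists for all $y\in\mathbb{C}$ and is entire in $y$. *)

theory Defs
  imports "HOL-Analysis.Analysis"
begin

text \<open>
  The rings \<open>k\<close>, \<open>R\<close> and the module \<open>M\<close> are the types \<open>'k\<close>, \<open>'r\<close>, \<open>'m\<close>. The structure map
  \<open>\<iota> :: 'k \<Rightarrow> 'r\<close> makes \<open>R\<close> a \<open>k\<close>-algebra, and \<open>act :: 'r \<Rightarrow> 'm \<Rightarrow> 'm\<close> is the action of \<open>R\<close> on \<open>M\<close>.
  Ideals of \<open>R\<close> are the subspaces of the module \<open>(*)\<close> over itself.
\<close>

section \<open>Commutative algebra\<close>

abbreviation is_ideal :: "'r::comm_ring_1 set \<Rightarrow> bool" where
  "is_ideal \<equiv> module.subspace (*)"

definition prime_ideal :: "'r::comm_ring_1 set \<Rightarrow> bool" where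
  "prime_ideal P \<longleftrightarrow> is_ideal P \<and> P \<noteq> UNIV \<and> (\<forall>a b. a * b \<in> P \<longrightarrow> a \<in> P \<or> b \<in> P)"

definition krull_dim :: "'r::comm_ring_1 itself \<Rightarrow> enat" where
  "krull_dim _ = Sup {enat n | n. \<exists>P :: nat \<Rightarrow> 'r set.
     (\<forall>i\<le>n. prime_ideal (P i)) \<and> (\<forall>i<n. P i \<subset> P (Suc i))}"

text \<open>
  The length of the quotient module \<open>V/N\<close>, for submodules \<open>N \<subseteq> V\<close> of an ambient module: the supremum
  of the lengths of strict chains of submodules of \<open>V/N\<close>, a submodule of \<open>V/N\<close> being given by its
  preimage, that is, by a submodule \<open>W\<close> of \<open>V\<close> containing \<open>N\<close>.
\<close>

definition quotient_length ::
    "('a::comm_ring_1 \<Rightarrow> 'b::ab_group_add \<Rightarrow> 'b) \<Rightarrow> 'b set \<Rightarrow> 'b set \<Rightarrow> enat" where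
  "quotient_length act V N = Sup {enat n | n. \<exists>W :: nat \<Rightarrow> 'b set.
     (\<forall>i\<le>n. module.subspace act (W i) \<and> N \<subseteq> W i \<and> W i \<subseteq> V) \<and>
     (\<forall>i<n. W i \<subset> W (Suc i))}"

definition finite_colength :: "'r::comm_ring_1 set \<Rightarrow> bool" where
  "finite_colength I \<longleftrightarrow> quotient_length (*) UNIV I < \<infinity>"

definition finitely_generated_module ::
    "('r::comm_ring_1 \<Rightarrow> 'm::ab_group_add \<Rightarrow> 'm) \<Rightarrow> bool" where
  "finitely_generated_module act \<longleftrightarrow>
     module act \<and> (\<exists>S. finite S \<and> module.span act S = UNIV)"

section \<open>Gradings\<close>

definition direct_sum_decomposition :: "(nat \<Rightarrow> 'a::ab_group_add set) \<Rightarrow> bool" where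
  "direct_sum_decomposition G \<longleftrightarrow>
     (\<forall>j. 0 \<in> G j \<and> (\<forall>x\<in>G j. \<forall>y\<in>G j. x - y \<in> G j)) \<and>
     (\<forall>x. \<exists>!f. (\<forall>j. f j \<in> G j) \<and> finite {j. f j \<noteq> 0} \<and> x = (\<Sum>j | f j \<noteq> 0. f j))"

definition is_ring_hom :: "('k::comm_ring_1 \<Rightarrow> 'r::comm_ring_1) \<Rightarrow> bool" where
  "is_ring_hom \<iota> \<longleftrightarrow>
     \<iota> 1 = 1 \<and> (\<forall>a b. \<iota> (a + b) = \<iota> a + \<iota> b) \<and> (\<forall>a b. \<iota> (a * b) = \<iota> a * \<iota> b)"

definition is_subalgebra :: "('k::comm_ring_1 \<Rightarrow> 'r::comm_ring_1) \<Rightarrow> 'r set \<Rightarrow> bool" where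
  "is_subalgebra \<iota> A \<longleftrightarrow>
     range \<iota> \<subseteq> A \<and> (\<forall>x\<in>A. \<forall>y\<in>A. x + y \<in> A \<and> x * y \<in> A)"

definition standard_graded_algebra ::
    "('k::field \<Rightarrow> 'r::comm_ring_1) \<Rightarrow> (nat \<Rightarrow> 'r set) \<Rightarrow> bool" where
  "standard_graded_algebra \<iota> Rg \<longleftrightarrow>
     is_ring_hom \<iota> \<and>
     direct_sum_decomposition Rg \<and>
     (\<forall>i j. \<forall>a\<in>Rg i. \<forall>b\<in>Rg j. a * b \<in> Rg (i + j)) \<and>
     Rg 0 = range \<iota> \<and>
     (\<exists>S. finite S \<and> S \<subseteq> Rg 1 \<and> is_subalgebra \<iota> hull S = UNIV)"

definition graded_module ::
    "(nat \<Rightarrow> 'r::comm_ring_1 set) \<Rightarrow> ('r \<Rightarrow> 'm::ab_group_add \<Rightarrow> 'm) \<Rightarrow> (nat \<Rightarrow> 'm set) \<Rightarrow> bool" where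
  "graded_module Rg act Mg \<longleftrightarrow>
     module act \<and>
     direct_sum_decomposition Mg \<and>
     (\<forall>i j. \<forall>a\<in>Rg i. \<forall>x\<in>Mg j. act a x \<in> Mg (i + j))"

definition homogeneous_ideal :: "(nat \<Rightarrow> 'r::comm_ring_1 set) \<Rightarrow> 'r set \<Rightarrow> bool" where
  "homogeneous_ideal Rg I \<longleftrightarrow> is_ideal I \<and> module.span (*) (I \<inter> (\<Union>j. Rg j)) = I"

definition piece :: "(nat \<Rightarrow> 'a::zero set) \<Rightarrow> int \<Rightarrow> 'a set" where
  "piece G j = (if j < 0 then {0} else G (nat j))"

section \<open>Frobenius powers and the Hilbert-Kunz density function\<close>

text \<open>For \<open>q = p ^ n\<close> this is the Frobenius power of \<open>I\<close>.\<close>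

definition frobenius_power :: "'r::comm_ring_1 set \<Rightarrow> nat \<Rightarrow> 'r set" where
  "frobenius_power I q = module.span (*) ((\<lambda>x. x ^ q) ` I)"

definition ideal_times_module ::
    "('r::comm_ring_1 \<Rightarrow> 'm::ab_group_add \<Rightarrow> 'm) \<Rightarrow> 'r set \<Rightarrow> 'm set" where
  "ideal_times_module act J = module.span act {act a x | a x. a \<in> J}"

text \<open>
  The length over \<open>k\<close> of the degree \<open>j\<close> piece of \<open>M/N\<close>, where \<open>N = I\<^sup>[\<^sup>q\<^sup>] M\<close>. That piece is the image of
  \<open>M\<^sub>j\<close> in \<open>M/N\<close>, i.e. \<open>(M\<^sub>j + N)/N\<close>.
\<close>

definition hk_length ::
    "('k::field \<Rightarrow> 'r::comm_ring_1) \<Rightarrow> ('r \<Rightarrow> 'm::ab_group_add \<Rightarrow> 'm) \<Rightarrow> (nat \<Rightarrow> 'm set) \<Rightarrow>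
     'r set \<Rightarrow> nat \<Rightarrow> int \<Rightarrow> nat" where
  "hk_length \<iota> act Mg I q j =
     (let N = ideal_times_module act (frobenius_power I q)
      in the_enat (quotient_length (\<lambda>c. act (\<iota> c)) {x + y | x y. x \<in> piece Mg j \<and> y \<in> N} N))"

definition hk_seq ::
    "nat \<Rightarrow> nat \<Rightarrow> ('k::field \<Rightarrow> 'r::comm_ring_1) \<Rightarrow> ('r \<Rightarrow> 'm::ab_group_add \<Rightarrow> 'm) \<Rightarrow>
     (nat \<Rightarrow> 'm set) \<Rightarrow> 'r set \<Rightarrow> nat \<Rightarrow> real \<Rightarrow> real" where
  "hk_seq p d \<iota> act Mg I n x =
     (1 / real p ^ n) ^ (d - 1) * real (hk_length \<iota> act Mg I (p ^ n) \<lfloor>x * real p ^ n\<rfloor>)"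

definition is_hk_density ::
    "nat \<Rightarrow> nat \<Rightarrow> ('k::field \<Rightarrow> 'r::comm_ring_1) \<Rightarrow> ('r \<Rightarrow> 'm::ab_group_add \<Rightarrow> 'm) \<Rightarrow>
     (nat \<Rightarrow> 'm set) \<Rightarrow> 'r set \<Rightarrow> (real \<Rightarrow> real) \<Rightarrow> bool" where
  "is_hk_density p d \<iota> act Mg I g \<longleftrightarrow>
     (\<forall>x. (\<lambda>n. hk_seq p d \<iota> act Mg I n x) \<longlonglongrightarrow> g x)"

definition frobenius_poincare ::
    "nat \<Rightarrow> nat \<Rightarrow> ('k::field \<Rightarrow> 'r::comm_ring_1) \<Rightarrow> ('r \<Rightarrow> 'm::ab_group_add \<Rightarrow> 'm) \<Rightarrow>
     (nat \<Rightarrow> 'm set) \<Rightarrow> 'r set \<Rightarrow> complex \<Rightarrow> complex" where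
  "frobenius_poincare p d \<iota> act Mg I y =
     lim (\<lambda>n. (1 / of_nat p ^ n) ^ d *
       (\<Sum>\<^sub>\<infinity>j::int. of_nat (hk_length \<iota> act Mg I (p ^ n) j) *
                exp (- \<i> * y * of_int j / of_nat p ^ n)))"

definition holomorphic_fourier :: "(real \<Rightarrow> real) \<Rightarrow> complex \<Rightarrow> complex" where
  "holomorphic_fourier h y = (LINT x|lebesgue. of_real (h x) * exp (- \<i> * y * of_real x))"

end

theory Submission
  imports Defs "HOL-Library.Fun_Lexorder"
begin

text \<open>
  Put \<open>q = p ^ n\<close>, let \<open>g\<^sub>n\<close> be the \<open>n\<close>-th approximation \<open>hk_seq\<close> of the density, and multiply it
  by \<open>exp (-iy \<lfloor>xq\<rfloor> / q)\<close>. The product \<open>s\<^sub>n\<close> is constant on each interval \<open>[j/q, (j+1)/q)\<close>, so its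
  integral is exactly the \<open>n\<close>-th term of the sequence whose limit is the Frobenius-Poincare function.
  Since \<open>\<lfloor>xq\<rfloor> / q\<close> tends to \<open>x\<close>, the \<open>s\<^sub>n\<close> converge pointwise to \<open>g x * exp (-iyx)\<close>. By dominated
  convergence the sequence of integrals therefore converges to the Fourier transform of \<open>g\<close>, as soon
  as the \<open>g\<^sub>n\<close> are supported in a common compact interval and have a common bound
  (\<open>fourier_transform_as_limit\<close>).

  The common support (\<open>pieces_vanish_in_high_degree\<close>) holds because \<open>I\<close> contains some \<open>R\<^sub>t\<close>: a monomial
  in \<open>r\<close> variables whose degree exceeds \<open>r t q\<close> contains some \<open>x\<^sub>l ^ (t q)\<close>, which lies in \<open>I\<^sup>[\<^sup>q\<^sup>]\<close>.

  For the common bound (\<open>hk_length_bounds\<close>) let \<open>H j\<close> be the dimension of \<open>M\<^sub>j\<close>. The lengths in question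
  are at most \<open>H j\<close>, and in degrees \<open>j < q\<close> they equal \<open>H j\<close> when \<open>I\<close> is proper, as \<open>I\<^sup>[\<^sup>q\<^sup>] M\<close>
  lives in degrees at least \<open>q\<close>; for \<open>I = R\<close> they all vanish. A Hilbert function satisfies a dichotomy: either
  \<open>H j = O(j ^ (d - 1))\<close>, or \<open>H j \<ge> c * j ^ d\<close> for large \<open>j\<close> and some \<open>c > 0\<close>
  (\<open>hilbert_function_growth\<close>). In the second case \<open>g\<^sub>n (1/p)\<close>, which is \<open>H (p ^ (n - 1))\<close> up to the
  factor \<open>p ^ (- n (d - 1))\<close>, would grow at least like \<open>p ^ n\<close>, although it converges to \<open>g (1/p)\<close>. So
  the first case holds, and it is the bound.

  The dichotomy itself is combinatorial. Choosing in each degree the monomials (times generators of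
  \<open>M\<close>) that are not combinations of smaller ones gives bases indexed, for each generator, by a set of
  exponent vectors that is closed under taking divisors. If this set contains all monomials in some \<open>d + 1\<close> of the variables, it has at least
  \<open>c * j ^ d\<close> elements of degree \<open>j\<close>. Otherwise there is a bound \<open>N\<close> such that at most \<open>d\<close> exponents of
  an element reach \<open>N\<close>, and once the others are chosen, the total degree fixes one of these; this
  leaves \<open>O(j ^ (d - 1))\<close> choices.
\<close>

section \<open>Lengths of quotients of vector spaces\<close>

context vector_space
begin

text \<open>
  The vectors witnessing that a chain from \<open>N\<close> is strict may be taken in \<open>span B\<close>, after subtracting
  elements of \<open>N\<close>; there they are linearly independent, so there are at most \<open>card B\<close> of them.
\<close>

lemma quotient_length_le:
  assumes B: "finite B" and N: "subspace N" and V: "V \<subseteq> span (N \<union> B)"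
  shows "quotient_length scale V N \<le> enat (card B)"
  unfolding quotient_length_def
proof (rule Sup_least, clarify)
  fix n and W :: "nat \<Rightarrow> 'b set"
  assume W: "\<forall>i\<le>n. subspace (W i) \<and> N \<subseteq> W i \<and> W i \<subseteq> V"
    and strict: "\<forall>i<n. W i \<subset> W (Suc i)"
  have "\<exists>w. w \<in> W (Suc i) \<and> w \<notin> W i \<and> w \<in> span B" if i: "i < n" for i
  proof -
    obtain u where u: "u \<in> W (Suc i)" "u \<notin> W i" using strict i by blast
    have "W (Suc i) \<subseteq> V" using W i by simp
    hence "u \<in> span (N \<union> B)" using u V by blast
    then obtain m w where mw: "u = m + w" "m \<in> span N" "w \<in> span B"
      unfolding span_Un by blast
    have m: "m \<in> N" using mw N by (metis span_eq_iff)
    have "N \<subseteq> W i" "N \<subseteq> W (Suc i)" "subspace (W i)" "subspace (W (Suc i))"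
      using W i by auto
    hence "w \<in> W (Suc i)" "w \<notin> W i"
      using m u mw subspace_diff[of "W (Suc i)" u m] subspace_add[of "W i" m w] by auto
    thus ?thesis using mw by blast
  qed
  then obtain w where w: "\<And>i. i < n \<Longrightarrow> w i \<in> W (Suc i) \<and> w i \<notin> W i \<and> w i \<in> span B"
    by metis
  have *: "independent (w ` {..<k}) \<and> inj_on w {..<k} \<and> w ` {..<k} \<subseteq> W k" if "k \<le> n" for k
    using that
  proof (induction k)
    case 0 show ?case by (simp add: independent_empty)
  next
    case (Suc k)
    hence k: "k < n" and IH: "independent (w ` {..<k})" "inj_on w {..<k}" "w ` {..<k} \<subseteq> W k"
      by auto
    have "span (w ` {..<k}) \<subseteq> W k" using IH W k by (intro span_minimal) auto
    hence nin: "w k \<notin> span (w ` {..<k})" using w[OF k] by blast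
    hence "w k \<notin> w ` {..<k}" by (meson span_base)
    moreover have "W k \<subseteq> W (Suc k)" using strict k by blast
    ultimately show ?case using IH w[OF k] independent_insertI[OF nin IH(1)]
      by (auto simp: lessThan_Suc)
  qed
  have "w ` {..<n} \<subseteq> span B" using w by blast
  hence "card (w ` {..<n}) \<le> card B"
    using independent_span_bound[OF B] *[of n] by simp
  thus "enat n \<le> enat (card B)" using *[of n] by (simp add: card_image)
qed

text \<open>
  Adjoining the elements of \<open>B\<close> to \<open>N\<close> one at a time gives a strict chain, since \<open>B\<close> remains
  independent modulo \<open>N\<close>.
\<close>

lemma quotient_length_ge:
  assumes N: "subspace N" and V: "subspace V" and NV: "N \<subseteq> V"
    and B: "finite B" "independent B" "B \<subseteq> V" "span B \<inter> N \<subseteq> {0}"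
  shows "enat (card B) \<le> quotient_length scale V N"
proof -
  define n where "n = card B"
  obtain b where b: "bij_betw b {0..<n} B"
    using ex_bij_betw_nat_finite[OF B(1)] unfolding n_def by blast
  define W where "W i = span (N \<union> b ` {0..<i})" for i
  have bB: "b ` {0..<i} \<subseteq> B" if "i \<le> n" for i
    using b that by (auto simp: bij_betw_def)
  have 1: "subspace (W i) \<and> N \<subseteq> W i \<and> W i \<subseteq> V" if "i \<le> n" for i
  proof -
    have "N \<union> b ` {0..<i} \<subseteq> V" using bB[OF that] B NV by blast
    hence "W i \<subseteq> V" unfolding W_def using V by (rule span_minimal)
    moreover have "N \<subseteq> W i" unfolding W_def using span_superset[of "N \<union> b ` {0..<i}"] by simp
    ultimately show ?thesis unfolding W_def using subspace_span by simp
  qed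
  have 2: "W i \<subset> W (Suc i)" if i: "i < n" for i
  proof -
    have "W i \<subseteq> W (Suc i)" unfolding W_def by (intro span_mono) auto
    moreover have "b i \<in> W (Suc i)" unfolding W_def by (intro span_base) auto
    moreover have "b i \<notin> W i"
    proof
      assume "b i \<in> W i"
      then obtain m w where mw: "b i = m + w" "m \<in> span N" "w \<in> span (b ` {0..<i})"
        unfolding W_def span_Un by blast
      have bi: "b i \<in> B" using b i by (auto simp: bij_betw_def)
      have m: "m \<in> N" using mw N by (metis span_eq_iff)
      have "w \<in> span B" using mw(3) bB[of i] i span_mono by (meson in_mono less_imp_le)
      hence "m \<in> span B" using mw(1) bi by (metis add_diff_cancel_right' span_base span_diff)
      hence "b i \<in> span (b ` {0..<i})" using m B(4) mw by auto
      moreover have "b k \<noteq> b i" if "k < i" for k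
        using bij_betw_imp_inj_on[OF b] that i by (auto dest: inj_onD)
      hence "b ` {0..<i} \<subseteq> B - {b i}" using bB[of i] i by auto
      ultimately have "b i \<in> span (B - {b i})" by (metis span_mono subsetD)
      thus False using B(2) bi by (auto simp: dependent_def)
    qed
    ultimately show ?thesis by blast
  qed
  show ?thesis unfolding quotient_length_def n_def[symmetric]
    by (rule Sup_upper) (use 1 2 in blast)
qed

text \<open>
  The greedy choice of a basis from an ordered spanning family: keep exactly the vectors that are not
  in the span of the smaller ones. The kept indices are stated explicitly since the basis obtained has
  a property that others lack: for monomials they are closed under divisors.
\<close>

lemma greedy_basis:
  fixes v :: "'i \<Rightarrow> 'b"
  assumes fin: "finite A"
    and irr: "\<And>a. \<not> prec a a" and tr: "\<And>a b c. prec a b \<Longrightarrow> prec b c \<Longrightarrow> prec a c"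
    and tot: "\<And>a b. a \<in> A \<Longrightarrow> b \<in> A \<Longrightarrow> a \<noteq> b \<Longrightarrow> prec a b \<or> prec b a"
  defines "St \<equiv> {a \<in> A. v a \<notin> span (v ` {b \<in> A. prec b a})}"
  shows "dim (span (v ` A)) = card St"
proof -
  have gen: "v a \<in> span (v ` St)" if "a \<in> A" for a
    using that
  proof (induction "card {b \<in> A. prec b a}" arbitrary: a rule: less_induct)
    case less
    show ?case
    proof (cases "a \<in> St")
      case True thus ?thesis by (simp add: span_base)
    next
      case False
      hence va: "v a \<in> span (v ` {b \<in> A. prec b a})" using less.prems by (simp add: St_def)
      have "v b \<in> span (v ` St)" if b: "b \<in> A" "prec b a" for b
      proof (rule less.hyps[OF _ b(1)])
        have "{c \<in> A. prec c b} \<subset> {c \<in> A. prec c a}" using b irr tr by blast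
        thus "card {c \<in> A. prec c b} < card {c \<in> A. prec c a}"
          using fin by (intro psubset_card_mono) auto
      qed
      hence "span (v ` {b \<in> A. prec b a}) \<subseteq> span (v ` St)"
        by (intro span_minimal) (auto simp: subspace_span)
      thus ?thesis using va by blast
    qed
  qed
  have StA: "St \<subseteq> A" by (auto simp: St_def)
  have ind: "independent (v ` X) \<and> inj_on v X" if "X \<subseteq> St" for X
    using that
  \<comment> \<open>Remove the largest index of \<open>X\<close>: its vector is not in the span of the others.\<close>
  proof (induction "card X" arbitrary: X)
    case 0
    hence "X = {}" using fin StA by (metis card_0_eq finite_subset subset_trans)
    thus ?case by (simp add: independent_empty)
  next
    case (Suc n)
    have finX: "finite X" using Suc.prems fin StA by (meson finite_subset)
    have "X \<noteq> {}" using Suc.hyps(2) by auto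
    then obtain x where x: "x \<in> X" "\<forall>y\<in>X. y \<noteq> x \<longrightarrow> \<not> prec x y"
      using Finite_Set.bex_max_element[OF finX, of prec] irr tr
      by (metis (no_types, lifting) asymp_on_def transp_on_def)
    have IH: "independent (v ` (X - {x})) \<and> inj_on v (X - {x})"
      using Suc x finX by (intro Suc.hyps(1)) auto
    have "X - {x} \<subseteq> {b \<in> A. prec b x}" using x tot Suc.prems StA by blast
    moreover have "v x \<notin> span (v ` {b \<in> A. prec b x})" using x Suc.prems by (auto simp: St_def)
    ultimately have nin: "v x \<notin> span (v ` (X - {x}))"
      using span_mono[OF image_mono] by (metis subsetD)
    have X: "insert x (X - {x}) = X" using x by blast
    have "v x \<notin> v ` (X - {x})" using nin by (meson span_base)
    hence "inj_on v (insert x (X - {x}))"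
      unfolding inj_on_insert using IH by simp
    moreover have "independent (v ` insert x (X - {x}))"
      unfolding image_insert using independent_insertI[OF nin conjunct1[OF IH]] .
    ultimately show ?case unfolding X by blast
  qed
  have "dim (span (v ` A)) = card (v ` St)"
  proof (rule dim_unique)
    show "v ` St \<subseteq> span (v ` A)" using StA span_superset by blast
    show "span (v ` A) \<subseteq> span (v ` St)"
      using gen by (intro span_minimal) (auto simp: subspace_span)
  qed (use ind in auto)
  also have "\<dots> = card St" using ind by (simp add: card_image)
  finally show ?thesis .
qed

end

section \<open>Counting exponent vectors\<close>

definition exponents :: "nat \<Rightarrow> nat \<Rightarrow> (nat \<Rightarrow> nat) set" where
  "exponents r j = {a. (\<forall>l\<ge>r. a l = 0) \<and> (\<Sum>l<r. a l) = j}"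

lemma finite_exponents: "finite (exponents r j)"
proof (rule finite_subset)
  show "exponents r j \<subseteq> {a. \<forall>l. (l \<in> {..<r} \<longrightarrow> a l \<in> {..j}) \<and> (l \<notin> {..<r} \<longrightarrow> a l = 0)}"
  proof (clarsimp simp: exponents_def)
    fix a :: "nat \<Rightarrow> nat" and l assume "l < r"
    thus "a l \<le> (\<Sum>l<r. a l)" by (intro member_le_sum) auto
  qed
  show "finite {a. \<forall>l. (l \<in> {..<r} \<longrightarrow> a l \<in> {..j}) \<and> (l \<notin> {..<r} \<longrightarrow> a l = (0::nat))}"
    by (intro finite_set_of_finite_funs) auto
qed

text \<open>
  Classify the vectors by the set \<open>F\<close> of positions whose entry is at least \<open>N\<close>. If \<open>F\<close> is not empty,
  one entry in \<open>F\<close> is determined by the others, because the total is \<open>j\<close>. So at most \<open>d - 1\<close> free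
  entries range up to \<open>j\<close>, and the remaining ones are below \<open>N\<close>.
\<close>

lemma card_exponents_few_large:
  assumes X: "X \<subseteq> exponents r j" and d: "d \<ge> 1"
    and few: "\<And>a. a \<in> X \<Longrightarrow> card {l\<in>{..<r}. a l \<ge> N} \<le> d"
  shows "card X \<le> 2 ^ r * (Suc N ^ r * Suc j ^ (d - 1))"
proof -
  define Y where "Y F = {a \<in> X. {l\<in>{..<r}. a l \<ge> N} = F}" for F
  have card_Y: "card (Y F) \<le> Suc N ^ r * Suc j ^ (d - 1)" if F: "F \<subseteq> {..<r}" for F
  proof (cases "Y F = {}")
    case False
    have finF: "finite F" using F finite_subset by blast
    have cF: "card F \<le> d" using False few by (auto simp: Y_def)
    \<comment> \<open>\<open>F - F0\<close> is the position left out: empty if \<open>F\<close> is, a single element otherwise.\<close>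
    obtain F0 where F0: "F0 \<subseteq> F" "card F0 \<le> d - 1" "card (F - F0) \<le> 1"
    proof (cases "F = {}")
      case True thus ?thesis using that[of "{}"] by simp
    next
      case False
      then obtain l where "l \<in> F" by blast
      moreover from this have "F - (F - {l}) = {l}" by blast
      ultimately show ?thesis using that[of "F - {l}"] finF cF by (auto simp: card_Diff_singleton)
    qed
    define L where "L = {..<r} - (F - F0)"
    define P where "P = (\<Pi>\<^sub>E l\<in>L. if l \<in> F0 then {..j} else {..<N})"
    have finL: "finite L" by (simp add: L_def)
    have le: "a l \<le> j" if "a \<in> X" "l < r" for a l
      using X that by (auto simp: exponents_def intro!: member_le_sum)
    have "(\<lambda>a. restrict a L) ` Y F \<subseteq> P"
    proof (clarsimp simp: P_def)
      fix a l assume a: "a \<in> Y F" and l: "l \<in> L"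
      have "l < r" "l \<notin> F - F0" using l by (auto simp: L_def)
      moreover have "a \<in> X" "{l\<in>{..<r}. a l \<ge> N} = F" using a by (auto simp: Y_def)
      ultimately show "(l \<in> F0 \<longrightarrow> a l \<le> j) \<and> (l \<notin> F0 \<longrightarrow> a l < N)"
        using le by (auto simp: not_le[symmetric])
    qed
    moreover have "inj_on (\<lambda>a. restrict a L) (Y F)"
    proof (rule inj_onI)
      fix a b assume a: "a \<in> Y F" and b: "b \<in> Y F" and eq: "restrict a L = restrict b L"
      have eqL: "a l = b l" if "l \<in> L" for l using eq that by (metis restrict_apply')
      have "a \<in> exponents r j" "b \<in> exponents r j" using a b X by (auto simp: Y_def)
      hence z: "\<forall>l\<ge>r. a l = 0 \<and> b l = 0" and s: "(\<Sum>l<r. a l) = (\<Sum>l<r. b l)"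
        by (auto simp: exponents_def)
      have split: "(\<Sum>l<r. f l) = (\<Sum>l\<in>L. f l) + (\<Sum>l\<in>F - F0. f l)" for f :: "nat \<Rightarrow> nat"
        using F by (subst sum.union_disjoint[symmetric])
          (auto simp: L_def finF intro!: sum.cong)
      have "(\<Sum>l\<in>L. a l) = (\<Sum>l\<in>L. b l)" using eqL by (intro sum.cong) auto
      hence "(\<Sum>l\<in>F - F0. a l) = (\<Sum>l\<in>F - F0. b l)" using s by (simp add: split)
      hence "a l = b l" if "l \<in> F - F0" for l
      proof -
        have "\<forall>k\<in>F - F0. k = l"
          using F0(3) that finF card_le_Suc0_iff_eq[of "F - F0"] by simp
        hence "F - F0 = {l}" using that by blast
        thus ?thesis using \<open>(\<Sum>l\<in>F - F0. a l) = (\<Sum>l\<in>F - F0. b l)\<close> by simp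
      qed
      thus "a = b" using eqL z by (intro ext) (metis DiffI L_def lessThan_iff not_le)
    qed
    ultimately have "card (Y F) \<le> card P"
      by (intro card_inj_on_le[of "\<lambda>a. restrict a L"]) (auto simp: P_def finL intro!: finite_PiE)
    also have "card P = (\<Prod>l\<in>L. if l \<in> F0 then Suc j else N)"
      unfolding P_def by (subst card_PiE[OF finL]) (auto intro!: prod.cong)
    also have "\<dots> \<le> (\<Prod>l\<in>L. Suc N * (if l \<in> F0 then Suc j else 1))"
      by (intro prod_mono) auto
    also have "\<dots> = Suc N ^ card L * Suc j ^ card (L \<inter> F0)"
      using finL by (simp add: prod.distrib prod.If_cases del: mult_Suc)
    also have "\<dots> \<le> Suc N ^ r * Suc j ^ (d - 1)"
    proof (intro mult_mono power_increasing)
      show "card L \<le> r" unfolding L_def by (metis card_lessThan card_mono Diff_subset finite_lessThan)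
      have "card (L \<inter> F0) \<le> card F0" using F0(1) finF by (intro card_mono) (auto intro: finite_subset)
      thus "card (L \<inter> F0) \<le> d - 1" using F0(2) by simp
    qed auto
    finally show ?thesis .
  qed auto
  have "X \<subseteq> (\<Union>F\<in>Pow {..<r}. Y F)"
  proof
    fix a assume "a \<in> X"
    hence "a \<in> Y {l\<in>{..<r}. a l \<ge> N}" by (simp add: Y_def)
    thus "a \<in> (\<Union>F\<in>Pow {..<r}. Y F)" by (rule UN_I[rotated]) blast
  qed
  moreover have finX: "finite X" using finite_subset[OF X finite_exponents] .
  ultimately have "card X \<le> card (\<Union>F\<in>Pow {..<r}. Y F)"
    by (intro card_mono finite_UN_I) (auto simp: Y_def)
  also have "\<dots> \<le> (\<Sum>F\<in>Pow {..<r}. card (Y F))" by (intro card_UN_le) auto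
  also have "\<dots> \<le> of_nat (card (Pow {..<r})) * (Suc N ^ r * Suc j ^ (d - 1))"
    using card_Y by (intro sum_bounded_above) auto
  finally show ?thesis by (simp add: card_Pow)
qed

text \<open>
  Choose \<open>d\<close> of the \<open>d + 1\<close> entries freely in \<open>{0..j div d}\<close>; their sum is at most \<open>j\<close>, and the last
  entry takes up the rest.
\<close>

lemma card_exponents_supported_ge:
  assumes F: "F \<subseteq> {..<r}" "card F = Suc d" and d: "d \<ge> 1"
  shows "Suc (j div d) ^ d \<le> card {a \<in> exponents r j. \<forall>l. l \<notin> F \<longrightarrow> a l = 0}"
proof -
  have finF: "finite F" using F finite_subset by blast
  obtain l0 where l0: "l0 \<in> F" using F(2) by fastforce
  define G where "G = F - {l0}"
  have G: "finite G" "card G = d" "l0 \<notin> G" "F = insert l0 G"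
    using finF F l0 by (auto simp: G_def)
  define P where "P = (\<Pi>\<^sub>E l\<in>G. {..j div d})"
  define \<phi> where "\<phi> b l = (if l \<in> G then b l else if l = l0 then j - (\<Sum>l\<in>G. b l) else 0)"
    for b :: "nat \<Rightarrow> nat" and l
  have "\<phi> ` P \<subseteq> {a \<in> exponents r j. \<forall>l. l \<notin> F \<longrightarrow> a l = 0}"
  proof clarify
    fix b assume b: "b \<in> P"
    have "(\<Sum>l\<in>G. b l) \<le> of_nat (card G) * (j div d)"
      using b by (intro sum_bounded_above) (auto simp: P_def PiE_iff)
    also have "\<dots> \<le> j" using G(2) by simp
    finally have le: "(\<Sum>l\<in>G. b l) \<le> j" .
    have "(\<Sum>l<r. \<phi> b l) = (\<Sum>l\<in>F. \<phi> b l)"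
      using F G by (intro sum.mono_neutral_right) (auto simp: \<phi>_def)
    also have "\<dots> = \<phi> b l0 + (\<Sum>l\<in>G. \<phi> b l)" using G by simp
    also have "(\<Sum>l\<in>G. \<phi> b l) = (\<Sum>l\<in>G. b l)" by (intro sum.cong) (auto simp: \<phi>_def)
    also have "\<phi> b l0 = j - (\<Sum>l\<in>G. b l)" using G by (simp add: \<phi>_def)
    finally have "(\<Sum>l<r. \<phi> b l) = j" using le by simp
    moreover have "\<phi> b l = 0" if "l \<notin> F" for l using that G by (auto simp: \<phi>_def)
    moreover have "l \<notin> F" if "r \<le> l" for l using F that by auto
    ultimately show "\<phi> b \<in> exponents r j \<and> (\<forall>l. l \<notin> F \<longrightarrow> \<phi> b l = 0)"
      by (simp add: exponents_def)
  qed
  moreover have "inj_on \<phi> P"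
  proof (rule inj_onI)
    fix b c assume b: "b \<in> P" and c: "c \<in> P" and eq: "\<phi> b = \<phi> c"
    have "b l = c l" if "l \<in> G" for l using fun_cong[OF eq, of l] that by (simp add: \<phi>_def)
    thus "b = c" using b c unfolding P_def by (metis PiE_ext)
  qed
  ultimately have "card P \<le> card {a \<in> exponents r j. \<forall>l. l \<notin> F \<longrightarrow> a l = 0}"
    by (intro card_inj_on_le) (auto intro: finite_subset[OF _ finite_exponents])
  moreover have "card P = Suc (j div d) ^ d" unfolding P_def using G by (simp add: card_PiE)
  ultimately show ?thesis by simp
qed

section \<open>A dichotomy for Hilbert functions\<close>

text \<open>
  The pair \<open>(i, a)\<close> stands for the product of the monomial with exponent vector \<open>a\<close> in \<open>r\<close> variables and
  the \<open>i\<close>-th of \<open>s\<close> generators, whose degree is \<open>e i\<close>; the set below collects those of degree \<open>j\<close>.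
\<close>

definition graded_index :: "nat \<Rightarrow> nat \<Rightarrow> (nat \<Rightarrow> nat) \<Rightarrow> nat \<Rightarrow> (nat \<times> (nat \<Rightarrow> nat)) set" where
  "graded_index s r e j = (SIGMA i:{i. i < s \<and> e i \<le> j}. exponents r (j - e i))"

lemma finite_graded_index: "finite (graded_index s r e j)"
  unfolding graded_index_def by (intro finite_SigmaI finite_exponents) simp

text \<open>
  A total order on the terms of one degree that is compatible with multiplication by monomials, as
  for Groebner bases of submodules of a free module.
\<close>

definition term_less :: "nat \<times> (nat \<Rightarrow> nat) \<Rightarrow> nat \<times> (nat \<Rightarrow> nat) \<Rightarrow> bool" where
  "term_less x y \<longleftrightarrow> fst x < fst y \<or> (fst x = fst y \<and> less_fun (snd x) (snd y))"

definition standard_terms ::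
    "('k::field \<Rightarrow> 'v::ab_group_add \<Rightarrow> 'v) \<Rightarrow> (nat \<times> (nat \<Rightarrow> nat) \<Rightarrow> 'v) \<Rightarrow>
     nat \<Rightarrow> nat \<Rightarrow> (nat \<Rightarrow> nat) \<Rightarrow> nat \<Rightarrow> (nat \<times> (nat \<Rightarrow> nat)) set" where
  "standard_terms scl v s r e j = {x \<in> graded_index s r e j.
     v x \<notin> module.span scl (v ` {y \<in> graded_index s r e j. term_less y x})}"

context vector_space
begin

lemma dim_eq_card_standard_terms:
  "dim (span (v ` graded_index s r e j)) = card (standard_terms scale v s r e j)"
  unfolding standard_terms_def
proof (rule greedy_basis[OF finite_graded_index])
  show "\<not> term_less x x" for x by (simp add: term_less_def less_fun_irrefl)
  show "term_less x z" if "term_less x y" "term_less y z" for x y z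
    using that by (auto simp: term_less_def intro: less_fun_trans)
  fix x y assume "x \<in> graded_index s r e j" "y \<in> graded_index s r e j" "x \<noteq> y"
  hence "snd x = snd y \<or> less_fun (snd x) (snd y) \<or> less_fun (snd y) (snd x)"
  proof -
    have "finite {l. snd x l \<noteq> snd y l}"
    proof (rule finite_subset)
      show "{l. snd x l \<noteq> snd y l} \<subseteq> {..<r}"
      proof
        fix l assume l: "l \<in> {l. snd x l \<noteq> snd y l}"
        have "snd x \<in> exponents r (j - e (fst x))" "snd y \<in> exponents r (j - e (fst y))"
          using \<open>x \<in> _\<close> \<open>y \<in> _\<close> unfolding graded_index_def by auto
        hence "r \<le> l \<Longrightarrow> snd x l = 0 \<and> snd y l = 0" by (simp add: exponents_def)
        thus "l \<in> {..<r}" using l by force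
      qed
    qed simp
    thus ?thesis using less_fun_trichotomy[of "snd x" "snd y"] by blast
  qed
  thus "term_less x y \<or> term_less y x"
    using \<open>x \<noteq> y\<close> by (auto simp: term_less_def prod_eq_iff)
qed

text \<open>
  The hypothesis \<open>shift\<close> abstracts multiplication by the monomial with exponent vector \<open>c\<close>: being linear,
  it preserves linear relations between terms. Hence a multiple of a non-standard term is
  non-standard, and the standard terms are closed under divisors. If for some generator and some
  \<open>d + 1\<close> variables all terms in these variables are standard, counting them gives the lower bound.
  Otherwise each choice of a generator and of \<open>d + 1\<close> variables has a non-standard term, and this
  excludes standard terms in which these \<open>d + 1\<close> exponents are all large.
\<close>

lemma hilbert_function_dichotomy:
  fixes v :: "nat \<times> (nat \<Rightarrow> nat) \<Rightarrow> 'b" and e :: "nat \<Rightarrow> nat" and s r d :: nat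
  defines "H \<equiv> \<lambda>j. dim (span (v ` graded_index s r e j))"
  assumes d: "d \<ge> 1"
    and shift: "\<And>i a c X. v (i, a) \<in> span (v ` X) \<Longrightarrow>
       v (i, \<lambda>l. a l + c l) \<in> span (v ` (\<lambda>(k, b). (k, \<lambda>l. b l + c l)) ` X)"
  shows "(\<exists>C. \<forall>j. real (H j) \<le> C * real (Suc j) ^ (d - 1)) \<or>
    (\<exists>c>0. \<exists>j0. \<forall>j\<ge>j0. c * real j ^ d \<le> real (H j))"
proof -
  define St where "St = standard_terms scale v s r e"
  define deg where "deg a = (\<Sum>l<r. a l)" for a :: "nat \<Rightarrow> nat"
  have H: "H j = card (St j)" for j
    unfolding H_def St_def by (rule dim_eq_card_standard_terms)
  have fin_St: "finite (St j)" for j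
    by (rule finite_subset[OF _ finite_graded_index[of s r e j]]) (auto simp: St_def standard_terms_def)
  \<comment> \<open>Closure under divisors: a relation making the divisor non-standard multiplies up to \<open>b\<close>.\<close>
  have divisor: "(i, a) \<in> St (deg a + e i)"
    if b: "(i, b) \<in> St j" and ab: "\<And>l. a l \<le> b l" for i a b j
  proof -
    define c where "c l = b l - a l" for l
    have bc: "b = (\<lambda>l. a l + c l)" using ab by (auto simp: c_def)
    have idx: "i < s" "e i \<le> j" "\<forall>l\<ge>r. b l = 0" "j = deg b + e i"
      using b by (auto simp: St_def standard_terms_def graded_index_def exponents_def deg_def)
    have a0: "\<forall>l\<ge>r. a l = 0" using idx(3) ab by (metis le_zero_eq)
    have j: "j = deg a + deg c + e i" using idx(4) by (simp add: bc deg_def sum.distrib)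
    define X where "X = {y \<in> graded_index s r e (deg a + e i). term_less y (i, a)}"
    have ia: "(i, a) \<in> graded_index s r e (deg a + e i)"
      using idx a0 by (auto simp: graded_index_def exponents_def deg_def)
    have c0: "\<forall>l\<ge>r. c l = 0" using idx(3) by (simp add: c_def)
    have "(\<lambda>(k, b). (k, \<lambda>l. b l + c l)) ` X \<subseteq> {y \<in> graded_index s r e j. term_less y (i, b)}"
    proof (clarsimp simp: X_def)
      fix k b' assume g: "(k, b') \<in> graded_index s r e (deg a + e i)" and t: "term_less (k, b') (i, a)"
      have "(k, \<lambda>l. b' l + c l) \<in> graded_index s r e j"
        using g c0 by (auto simp: graded_index_def exponents_def sum.distrib j deg_def)
      moreover have "term_less (k, \<lambda>l. b' l + c l) (i, b)"
        using t by (auto simp: term_less_def less_fun_def bc)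
      ultimately show "(k, \<lambda>l. b' l + c l) \<in> graded_index s r e j \<and>
          term_less (k, \<lambda>l. b' l + c l) (i, b)" by blast
    qed
    hence sub: "span (v ` (\<lambda>(k, b). (k, \<lambda>l. b l + c l)) ` X) \<subseteq>
        span (v ` {y \<in> graded_index s r e j. term_less y (i, b)})"
      by (intro span_mono image_mono)
    have "v (i, b) \<notin> span (v ` {y \<in> graded_index s r e j. term_less y (i, b)})"
      using b by (simp add: St_def standard_terms_def)
    hence "v (i, a) \<notin> span (v ` X)"
      using subsetD[OF sub shift[of i a X c]] unfolding bc by (rule contrapos_nn)
    thus ?thesis using ia by (simp add: St_def standard_terms_def X_def)
  qed
  show ?thesis
  proof (cases "\<exists>i F. i < s \<and> F \<subseteq> {..<r} \<and> card F = Suc d \<and>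
      (\<forall>a. (\<forall>l. l \<notin> F \<longrightarrow> a l = 0) \<longrightarrow> (i, a) \<in> St (deg a + e i))")
    case True
    then obtain i F where i: "i < s" and F: "F \<subseteq> {..<r}" "card F = Suc d"
      and all: "\<And>a. (\<And>l. l \<notin> F \<Longrightarrow> a l = 0) \<Longrightarrow> (i, a) \<in> St (deg a + e i)"
      by blast
    have "(1 / (2 * real d)) ^ d * real j ^ d \<le> real (H j)" if j: "j \<ge> 2 * e i" for j
    proof -
      define E where "E = {a \<in> exponents r (j - e i). \<forall>l. l \<notin> F \<longrightarrow> a l = 0}"
      have "Pair i ` E \<subseteq> St j"
      proof clarify
        fix a assume "a \<in> E"
        hence "deg a = j - e i" "\<And>l. l \<notin> F \<Longrightarrow> a l = 0"
          by (auto simp: E_def exponents_def deg_def)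
        thus "(i, a) \<in> St j" using all[of a] j by simp
      qed
      hence "card (Pair i ` E) \<le> card (St j)" by (intro card_mono fin_St)
      moreover have "card (Pair i ` E) = card E" by (intro card_image inj_onI) simp
      moreover have "Suc ((j - e i) div d) ^ d \<le> card E"
        unfolding E_def by (rule card_exponents_supported_ge[OF F d])
      ultimately have "Suc ((j - e i) div d) ^ d \<le> H j" by (simp add: H)
      hence "real (Suc ((j - e i) div d) ^ d) \<le> real (H j)" by (rule of_nat_mono)
      hence ge: "real (Suc ((j - e i) div d)) ^ d \<le> real (H j)" by (metis of_nat_power)
      have "j \<le> 2 * (j - e i)" using j by simp
      also have "j - e i \<le> d * Suc ((j - e i) div d)"
        using d dividend_less_times_div[of d "j - e i"] by simp
      finally have "j \<le> 2 * d * Suc ((j - e i) div d)" by simp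
      hence "real j \<le> real (2 * d * Suc ((j - e i) div d))" by (rule of_nat_mono)
      hence "1 / (2 * real d) * real j \<le> real (Suc ((j - e i) div d))"
        using d by (simp add: field_simps)
      hence "(1 / (2 * real d) * real j) ^ d \<le> real (Suc ((j - e i) div d)) ^ d"
        by (intro power_mono) auto
      from order_trans[OF this ge] show ?thesis by (simp only: power_mult_distrib)
    qed
    moreover have "(1 / (2 * real d)) ^ d > 0" using d by simp
    ultimately show ?thesis by blast
  next
    case False
    hence "\<forall>i F. \<exists>a. i < s \<and> F \<subseteq> {..<r} \<and> card F = Suc d \<longrightarrow>
        (\<forall>l. l \<notin> F \<longrightarrow> a l = 0) \<and> (i, a) \<notin> St (deg a + e i)" by blast
    then obtain w where w: "\<And>i F. i < s \<Longrightarrow> F \<subseteq> {..<r} \<Longrightarrow> card F = Suc d \<Longrightarrow>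
        (\<forall>l. l \<notin> F \<longrightarrow> w i F l = 0) \<and> (i, w i F) \<notin> St (deg (w i F) + e i)" by metis
    \<comment> \<open>Any common bound of the exponents of these finitely many witnesses would do as \<open>N\<close>.\<close>
    define N where "N = (\<Sum>i<s. \<Sum>F\<in>Pow {..<r}. \<Sum>l<r. w i F l)"
    have wN: "w i F l \<le> N" if "i < s" "F \<subseteq> {..<r}" "l < r" for i F l
    proof -
      have "w i F l \<le> (\<Sum>l<r. w i F l)" using that by (intro member_le_sum) auto
      also have "\<dots> \<le> (\<Sum>F\<in>Pow {..<r}. \<Sum>l<r. w i F l)"
        using that by (intro member_le_sum[of F _ "\<lambda>F. \<Sum>l<r. w i F l"]) auto
      also have "\<dots> \<le> N" unfolding N_def
        using that by (intro member_le_sum[of i _ "\<lambda>i. \<Sum>F\<in>Pow {..<r}. \<Sum>l<r. w i F l"]) auto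
      finally show ?thesis .
    qed
    define K where "K = 2 ^ r * Suc N ^ r"
    have "real (H j) \<le> real (s * K) * real (Suc j) ^ (d - 1)" for j
    proof -
      define X where "X i = {a. (i, a) \<in> St j}" for i
      have X: "X i \<subseteq> exponents r (j - e i)" for i
        by (auto simp: X_def St_def standard_terms_def graded_index_def)
      have card_X: "card (X i) \<le> K * Suc j ^ (d - 1)" if i: "i < s" for i
      proof -
        have "card (X i) \<le> 2 ^ r * (Suc N ^ r * Suc (j - e i) ^ (d - 1))"
        proof (rule card_exponents_few_large[OF X d])
          fix a assume a: "a \<in> X i"
          show "card {l \<in> {..<r}. N \<le> a l} \<le> d"
          proof (rule ccontr)
            assume "\<not> card {l \<in> {..<r}. N \<le> a l} \<le> d"
            hence "Suc d \<le> card {l \<in> {..<r}. N \<le> a l}" by simp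
            then obtain F where F: "F \<subseteq> {l \<in> {..<r}. N \<le> a l}" "card F = Suc d"
              by (meson obtain_subset_with_card_n)
            have Fr: "F \<subseteq> {..<r}" using F by blast
            have "w i F l \<le> a l" for l
            proof (cases "l \<in> F")
              case True
              hence "w i F l \<le> N" "N \<le> a l" using wN[OF i Fr] F by auto
              thus ?thesis by simp
            next
              case False thus ?thesis using w[OF i Fr F(2)] by simp
            qed
            hence "(i, w i F) \<in> St (deg (w i F) + e i)" using divisor a by (simp add: X_def)
            thus False using w[OF i Fr F(2)] by blast
          qed
        qed
        also have "\<dots> \<le> 2 ^ r * (Suc N ^ r * Suc j ^ (d - 1))"
          by (intro mult_le_mono2 power_mono) auto
        finally show ?thesis by (simp add: K_def mult.assoc del: mult_Suc power_Suc)
      qed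
      have "St j = (SIGMA i:{..<s}. X i)"
        by (auto simp: X_def St_def standard_terms_def graded_index_def)
      hence "H j = (\<Sum>i<s. card (X i))"
        using finite_subset[OF X finite_exponents] by (simp add: H card_SigmaI)
      also have "\<dots> \<le> of_nat (card {..<s}) * (K * Suc j ^ (d - 1))"
        using card_X by (intro sum_bounded_above) auto
      finally have "H j \<le> (s * K) * Suc j ^ (d - 1)" by (simp add: mult.assoc)
      hence "real (H j) \<le> real ((s * K) * Suc j ^ (d - 1))" by (rule of_nat_mono)
      thus ?thesis by (simp only: of_nat_mult of_nat_power)
    qed
    thus ?thesis by blast
  qed
qed

end

section \<open>Homogeneous components\<close>

definition component :: "(nat \<Rightarrow> 'a::ab_group_add set) \<Rightarrow> 'a \<Rightarrow> nat \<Rightarrow> 'a" where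
  "component G x =
     (THE f. (\<forall>j. f j \<in> G j) \<and> finite {j. f j \<noteq> 0} \<and> x = (\<Sum>j | f j \<noteq> 0. f j))"

definition in_degrees_ge :: "(nat \<Rightarrow> 'a::ab_group_add set) \<Rightarrow> nat \<Rightarrow> 'a set" where
  "in_degrees_ge G q = {x. \<forall>j<q. component G x j = 0}"

lemma component_props:
  assumes "direct_sum_decomposition G"
  shows component_in: "component G x j \<in> G j"
    and finite_component: "finite {j. component G x j \<noteq> 0}"
    and sum_component: "(\<Sum>j | component G x j \<noteq> 0. component G x j) = x"
proof -
  have "\<exists>!f. (\<forall>j. f j \<in> G j) \<and> finite {j. f j \<noteq> 0} \<and> x = (\<Sum>j | f j \<noteq> 0. f j)"
    using assms by (simp add: direct_sum_decomposition_def)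
  from theI'[OF this, folded component_def]
  show "component G x j \<in> G j" "finite {j. component G x j \<noteq> 0}"
    "(\<Sum>j | component G x j \<noteq> 0. component G x j) = x" by auto
qed

lemma component_eqI:
  assumes "direct_sum_decomposition G"
    and "\<And>j. f j \<in> G j" and "finite A" "{j. f j \<noteq> 0} \<subseteq> A" and "x = (\<Sum>j\<in>A. f j)"
  shows "component G x = f"
proof -
  have 1: "\<exists>!f. (\<forall>j. f j \<in> G j) \<and> finite {j. f j \<noteq> 0} \<and> x = (\<Sum>j | f j \<noteq> 0. f j)"
    using assms(1) by (simp add: direct_sum_decomposition_def)
  have "x = (\<Sum>j | f j \<noteq> 0. f j)"
    unfolding assms(5) using assms(3,4) by (intro sum.mono_neutral_right) auto
  moreover have "finite {j. f j \<noteq> 0}" using assms(3,4) finite_subset by blast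
  ultimately show ?thesis unfolding component_def using assms(2)
    by (intro the1_equality[OF 1]) auto
qed

lemma graded_zero: "direct_sum_decomposition G \<Longrightarrow> 0 \<in> G j"
  by (simp add: direct_sum_decomposition_def)

lemma graded_diff: "direct_sum_decomposition G \<Longrightarrow> x \<in> G j \<Longrightarrow> y \<in> G j \<Longrightarrow> x - y \<in> G j"
  by (simp add: direct_sum_decomposition_def)

lemma graded_add:
  assumes "direct_sum_decomposition G" "x \<in> G j" "y \<in> G j"
  shows "x + y \<in> G j"
  using graded_diff[OF assms(1,2) graded_diff[OF assms(1) graded_zero[OF assms(1)] assms(3)]] by simp

lemma component_homogeneous:
  assumes "direct_sum_decomposition G" "x \<in> G i"
  shows "component G x j = (if j = i then x else 0)"
proof -
  have "component G x = (\<lambda>j. if j = i then x else 0)"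
    by (rule component_eqI[where A = "{i}"]) (use assms graded_zero in auto)
  thus ?thesis by simp
qed

lemma component_zero: "direct_sum_decomposition G \<Longrightarrow> component G 0 j = 0"
  using component_homogeneous[of G 0 0 j] graded_zero[of G 0] by auto

lemma component_add:
  assumes G: "direct_sum_decomposition G"
  shows "component G (x + y) j = component G x j + component G y j"
proof -
  define A where "A = {j. component G x j \<noteq> 0} \<union> {j. component G y j \<noteq> 0}"
  have fin: "finite A" using finite_component[OF G] by (simp add: A_def)
  have "x = (\<Sum>j\<in>A. component G x j)"
    by (subst sum_component[OF G, symmetric], rule sum.mono_neutral_left) (use fin in \<open>auto simp: A_def\<close>)
  moreover have "y = (\<Sum>j\<in>A. component G y j)"
    by (subst sum_component[OF G, symmetric], rule sum.mono_neutral_left) (use fin in \<open>auto simp: A_def\<close>)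
  ultimately have "x + y = (\<Sum>j\<in>A. component G x j + component G y j)"
    by (metis sum.distrib)
  hence "component G (x + y) = (\<lambda>j. component G x j + component G y j)"
    using component_in[OF G] by (intro component_eqI[OF G _ fin]) (auto simp: A_def intro: graded_add[OF G])
  thus ?thesis by simp
qed

lemma component_sum:
  assumes "direct_sum_decomposition G"
  shows "component G (sum f A) j = (\<Sum>a\<in>A. component G (f a) j)"
  by (induction A rule: infinite_finite_induct)
    (simp_all add: component_zero[OF assms] component_add[OF assms])

lemma in_degrees_ge_zero: "direct_sum_decomposition G \<Longrightarrow> 0 \<in> in_degrees_ge G q"
  by (simp add: in_degrees_ge_def component_zero)

lemma in_degrees_ge_add:
  "direct_sum_decomposition G \<Longrightarrow> x \<in> in_degrees_ge G q \<Longrightarrow> y \<in> in_degrees_ge G q \<Longrightarrow>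
    x + y \<in> in_degrees_ge G q"
  by (simp add: in_degrees_ge_def component_add)

lemma in_degrees_ge_sum:
  assumes "direct_sum_decomposition G" "\<And>a. a \<in> A \<Longrightarrow> f a \<in> in_degrees_ge G q"
  shows "sum f A \<in> in_degrees_ge G q"
  using assms by (simp add: in_degrees_ge_def component_sum)

lemma homogeneous_in_degrees_ge:
  "direct_sum_decomposition G \<Longrightarrow> x \<in> G j \<Longrightarrow> q \<le> j \<Longrightarrow> x \<in> in_degrees_ge G q"
  by (auto simp: in_degrees_ge_def component_homogeneous)

lemma in_degrees_ge_0: "in_degrees_ge G 0 = UNIV"
  by (simp add: in_degrees_ge_def)

lemma in_degrees_ge_antimono: "q \<le> q' \<Longrightarrow> in_degrees_ge G q' \<subseteq> in_degrees_ge G q"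
  by (auto simp: in_degrees_ge_def)

lemma in_degrees_ge_act:
  assumes R: "direct_sum_decomposition Rg" and M: "graded_module Rg act Mg"
    and a: "a \<in> in_degrees_ge Rg u" and x: "x \<in> in_degrees_ge Mg v"
  shows "act a x \<in> in_degrees_ge Mg (u + v)"
proof -
  interpret module act using M by (simp add: graded_module_def)
  have Md: "direct_sum_decomposition Mg" using M by (simp add: graded_module_def)
  have "act a x = act (\<Sum>i | component Rg a i \<noteq> 0. component Rg a i)
      (\<Sum>j | component Mg x j \<noteq> 0. component Mg x j)"
    by (simp add: sum_component[OF R] sum_component[OF Md])
  also have "\<dots> = (\<Sum>i | component Rg a i \<noteq> 0. \<Sum>j | component Mg x j \<noteq> 0.
      act (component Rg a i) (component Mg x j))"
    by (simp only: scale_sum_left) (simp only: scale_sum_right)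
  also have "\<dots> \<in> in_degrees_ge Mg (u + v)"
  proof (intro in_degrees_ge_sum[OF Md])
    fix i j assume i: "i \<in> {i. component Rg a i \<noteq> 0}" and j: "j \<in> {j. component Mg x j \<noteq> 0}"
    have "u \<le> i" using a i by (auto simp: in_degrees_ge_def not_less[symmetric])
    moreover have "v \<le> j" using x j by (auto simp: in_degrees_ge_def not_less[symmetric])
    moreover have "act (component Rg a i) (component Mg x j) \<in> Mg (i + j)"
      using M component_in[OF R] component_in[OF Md] by (simp add: graded_module_def)
    ultimately show "act (component Rg a i) (component Mg x j) \<in> in_degrees_ge Mg (u + v)"
      by (intro homogeneous_in_degrees_ge[OF Md]) auto
  qed
  finally show ?thesis .
qed

section \<open>Homogeneous ideals of finite colength\<close>

lemma module_ring: "module ((*) :: 'r::comm_ring_1 \<Rightarrow> 'r \<Rightarrow> 'r)"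
  by unfold_locales (simp_all add: algebra_simps)

lemma standard_graded_algebraD:
  assumes "standard_graded_algebra \<iota> Rg"
  shows "is_ring_hom \<iota>" "direct_sum_decomposition Rg" "Rg 0 = range \<iota>"
    "\<And>i j a b. a \<in> Rg i \<Longrightarrow> b \<in> Rg j \<Longrightarrow> a * b \<in> Rg (i + j)"
    "graded_module Rg (*) Rg"
  using assms module_ring by (auto simp: standard_graded_algebra_def graded_module_def)

text \<open>
  It suffices to consider a multiple \<open>c * z\<close> of a homogeneous element \<open>z\<close> of \<open>I\<close>: its components are the
  products of \<open>z\<close> with the components of \<open>c\<close>.
\<close>

lemma homogeneous_ideal_component:
  assumes R: "standard_graded_algebra \<iota> Rg" and I: "homogeneous_ideal Rg I" and x: "x \<in> I"
  shows "component Rg x j \<in> I"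
proof -
  interpret module "(*) :: 'b \<Rightarrow> 'b \<Rightarrow> 'b" by (rule module_ring)
  note D = standard_graded_algebraD(2)[OF R]
  have sub: "subspace I" using I by (simp add: homogeneous_ideal_def)
  have "x \<in> span (I \<inter> (\<Union>j. Rg j))" using I x by (simp add: homogeneous_ideal_def)
  thus ?thesis
  proof (induction rule: span_induct_alt)
    case base show ?case by (simp add: component_zero[OF D] subspace_0[OF sub])
  next
    case (step c z y)
    then obtain i where z: "z \<in> I" "z \<in> Rg i" by blast
    have "component Rg (c * z) j \<in> I"
    proof -
      have "c * z = (\<Sum>u | component Rg c u \<noteq> 0. component Rg c u * z)"
        by (metis sum_component[OF D] sum_distrib_right)
      also have "component Rg \<dots> j = (\<Sum>u | component Rg c u \<noteq> 0. component Rg (component Rg c u * z) j)"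
        by (rule component_sum[OF D])
      also have "\<dots> \<in> I"
      proof (intro subspace_sum[OF sub])
        fix u
        have "component Rg c u * z \<in> Rg (u + i)"
          using standard_graded_algebraD(4)[OF R component_in[OF D] z(2)] .
        thus "component Rg (component Rg c u * z) j \<in> I"
          using component_homogeneous[OF D] subspace_scale[OF sub z(1)] subspace_0[OF sub] by simp
      qed
      finally show ?thesis .
    qed
    thus ?case using step subspace_add[OF sub] by (simp add: component_add[OF D])
  qed
qed

text \<open>
  The ideals \<open>I + R\<^sub>\<ge>\<^sub>t\<close> descend with \<open>t\<close> and contain \<open>I\<close>, so by finite colength two consecutive
  ones agree. Comparing components of degree \<open>t\<close> in \<open>R\<^sub>t \<subseteq> I + R\<^sub>\<ge>\<^sub>t\<^sub>+\<^sub>1\<close> gives \<open>R\<^sub>t \<subseteq> I\<close>, because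
  \<open>I\<close> is homogeneous.
\<close>

lemma finite_colength_contains_degree:
  assumes R: "standard_graded_algebra \<iota> Rg" and I: "homogeneous_ideal Rg I"
    and fin: "finite_colength I"
  shows "\<exists>t. Rg t \<subseteq> I"
proof -
  interpret module "(*) :: 'b \<Rightarrow> 'b \<Rightarrow> 'b" by (rule module_ring)
  note D = standard_graded_algebraD(2)[OF R]
  have sub: "subspace I" using I by (simp add: homogeneous_ideal_def)
  define V where "V q = {a + b | a b. a \<in> I \<and> b \<in> in_degrees_ge Rg q}" for q
  have ge_sub: "subspace (in_degrees_ge Rg q)" for q
  proof (rule subspaceI)
    fix c x assume "x \<in> in_degrees_ge Rg q"
    thus "c * x \<in> in_degrees_ge Rg q"
      using in_degrees_ge_act[OF D standard_graded_algebraD(5)[OF R], of c 0 x q]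
      by (simp add: in_degrees_ge_0)
  qed (auto intro: in_degrees_ge_zero[OF D] in_degrees_ge_add[OF D])
  have V_sub: "subspace (V q)" for q
  proof (rule subspaceI)
    show "0 \<in> V q" unfolding V_def using subspace_0[OF sub] in_degrees_ge_zero[OF D]
      by (auto intro!: exI[of _ 0])
    fix x y assume "x \<in> V q" "y \<in> V q"
    then obtain a b a' b' where *: "x = a + b" "y = a' + b'" "a \<in> I" "a' \<in> I"
        "b \<in> in_degrees_ge Rg q" "b' \<in> in_degrees_ge Rg q" unfolding V_def by blast
    have "x + y = (a + a') + (b + b')" using * by simp
    moreover have "a + a' \<in> I" "b + b' \<in> in_degrees_ge Rg q"
      using * subspace_add[OF sub] in_degrees_ge_add[OF D] by auto
    ultimately show "x + y \<in> V q" unfolding V_def by blast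
  next
    fix c x assume "x \<in> V q"
    then obtain a b where *: "x = a + b" "a \<in> I" "b \<in> in_degrees_ge Rg q" unfolding V_def by blast
    have "c * x = c * a + c * b" using * by (simp add: algebra_simps)
    moreover have "c * a \<in> I" "c * b \<in> in_degrees_ge Rg q"
      using * subspace_scale[OF sub] subspace_scale[OF ge_sub] by auto
    ultimately show "c * x \<in> V q" unfolding V_def by blast
  qed
  have V_I: "I \<subseteq> V q" for q
  proof
    fix a assume "a \<in> I"
    moreover have "a = a + 0" by simp
    ultimately show "a \<in> V q" unfolding V_def using in_degrees_ge_zero[OF D] by blast
  qed
  have V_mono: "V (Suc q) \<subseteq> V q" for q
    unfolding V_def using in_degrees_ge_antimono[of q "Suc q" Rg] by auto
  have "\<exists>t. V (Suc t) = V t"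
  proof (rule ccontr)
    assume "\<not> ?thesis"
    hence strict: "V (Suc t) \<subset> V t" for t using V_mono by blast
    have "enat n \<le> quotient_length (*) UNIV I" for n
      unfolding quotient_length_def
    proof (rule Sup_upper, intro CollectI exI[of _ n] conjI refl exI[of _ "\<lambda>i. V (n - i)"] allI impI)
      fix i assume "i < n"
      hence "n - i = Suc (n - Suc i)" by simp
      thus "V (n - i) \<subset> V (n - Suc i)" using strict by simp
    qed (use V_sub V_I in auto)
    hence "quotient_length (*) UNIV I = \<infinity>"
      by (metis enat_ord_simps(4) enat_iless linorder_not_less less_imp_le less_irrefl not_infinity_eq enat_ord_simps(1) Suc_n_not_le_n)
    thus False using fin by (simp add: finite_colength_def)
  qed
  then obtain t where t: "V (Suc t) = V t" by blast
  have "Rg t \<subseteq> I"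
  proof
    fix z assume z: "z \<in> Rg t"
    have "0 + z \<in> V t" unfolding V_def
      using subspace_0[OF sub] homogeneous_in_degrees_ge[OF D z] by blast
    hence "z \<in> V (Suc t)" using t by simp
    then obtain a b where ab: "z = a + b" "a \<in> I" "b \<in> in_degrees_ge Rg (Suc t)"
      unfolding V_def by blast
    have "z = component Rg z t" using component_homogeneous[OF D z] by simp
    also have "\<dots> = component Rg a t" using ab by (simp add: component_add[OF D] in_degrees_ge_def)
    finally show "z \<in> I" using homogeneous_ideal_component[OF R I ab(2), of t] by simp
  qed
  thus ?thesis by blast
qed

text \<open>
  The degree 0 component of an element of \<open>I\<close> lies in \<open>I\<close> and comes from the field, so it would be a
  unit in \<open>I\<close> if it were not zero.
\<close>

lemma proper_homogeneous_ideal_positive: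
  assumes R: "standard_graded_algebra \<iota> Rg" and I: "homogeneous_ideal Rg I" and "I \<noteq> UNIV"
  shows "I \<subseteq> in_degrees_ge Rg 1"
proof
  interpret module "(*) :: 'b \<Rightarrow> 'b \<Rightarrow> 'b" by (rule module_ring)
  note D = standard_graded_algebraD(2)[OF R]
  have sub: "subspace I" using I by (simp add: homogeneous_ideal_def)
  fix x assume x: "x \<in> I"
  have "component Rg x 0 \<in> range \<iota>"
    using component_in[OF D, of x 0] standard_graded_algebraD(3)[OF R] by simp
  then obtain c where c: "component Rg x 0 = \<iota> c" by blast
  have hom: "\<iota> 1 = 1" "\<And>a b. \<iota> (a * b) = \<iota> a * \<iota> b" "\<And>a b. \<iota> (a + b) = \<iota> a + \<iota> b"
    using standard_graded_algebraD(1)[OF R] by (auto simp: is_ring_hom_def)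
  have "c = 0"
  proof (rule ccontr)
    assume "c \<noteq> 0"
    hence "\<iota> (inverse c) * \<iota> c = 1" using hom(1) hom(2)[of "inverse c" c] by simp
    hence "1 \<in> I" using subspace_scale[OF sub homogeneous_ideal_component[OF R I x, of 0], of "\<iota> (inverse c)"] c
      by simp
    hence "y \<in> I" for y using subspace_scale[OF sub, of 1 y] by simp
    thus False using assms(3) by blast
  qed
  moreover have "\<iota> 0 = 0" using hom(3)[of 0 0] by simp
  ultimately show "x \<in> in_degrees_ge Rg 1" using c by (simp add: in_degrees_ge_def)
qed

section \<open>Monomials span the graded pieces\<close>

lemma vector_space_via_ring_hom:
  fixes \<iota> :: "'k::field \<Rightarrow> 'r::comm_ring_1"
  assumes hom: "is_ring_hom \<iota>" and "module act"
  shows "vector_space (\<lambda>c. act (\<iota> c))"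
proof -
  interpret module act by fact
  have "\<iota> 1 = 1" "\<And>a b. \<iota> (a * b) = \<iota> a * \<iota> b" "\<And>a b. \<iota> (a + b) = \<iota> a + \<iota> b"
    using hom by (auto simp: is_ring_hom_def)
  thus ?thesis by unfold_locales (simp_all add: scale_right_distrib scale_left_distrib)
qed

definition monomial :: "(nat \<Rightarrow> 'r::comm_ring_1) \<Rightarrow> nat \<Rightarrow> (nat \<Rightarrow> nat) \<Rightarrow> 'r" where
  "monomial x r a = (\<Prod>l<r. x l ^ a l)"

lemma monomial_mult: "monomial x r a * monomial x r b = monomial x r (\<lambda>l. a l + b l)"
  by (simp add: monomial_def power_add prod.distrib)

lemma monomial_in_degree:
  assumes R: "standard_graded_algebra \<iota> Rg" and x: "\<And>l. l < r \<Longrightarrow> x l \<in> Rg 1"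
  shows "monomial x r a \<in> Rg (\<Sum>l<r. a l)"
proof -
  have one: "1 \<in> Rg 0"
    using standard_graded_algebraD(1,3)[OF R] by (metis is_ring_hom_def rangeI)
  have pow: "x l ^ n \<in> Rg n" if "l < r" for l n
  proof (induction n)
    case (Suc n) show ?case using standard_graded_algebraD(4)[OF R x[OF that] Suc] by simp
  qed (simp add: one)
  have "u \<le> r \<Longrightarrow> monomial x u a \<in> Rg (\<Sum>l<u. a l)" for u
  proof (induction u)
    case 0 show ?case using one by (simp add: monomial_def)
  next
    case (Suc u)
    hence "monomial x u a * x u ^ a u \<in> Rg ((\<Sum>l<u. a l) + a u)"
      by (intro standard_graded_algebraD(4)[OF R] pow) auto
    thus ?case by (simp add: monomial_def)
  qed
  thus ?thesis by simp
qed

text \<open>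
  The span of the monomials is closed under multiplication, so it is a subalgebra containing the
  generators.
\<close>

lemma monomials_span_algebra:
  fixes \<iota> :: "'k::field \<Rightarrow> 'r::comm_ring_1"
  assumes R: "standard_graded_algebra \<iota> Rg"
  obtains x r where "\<And>l. l < r \<Longrightarrow> x l \<in> Rg 1"
    "\<And>y. y \<in> module.span (\<lambda>c. (*) (\<iota> c)) (range (monomial x r))"
proof -
  obtain S where S: "finite S" "S \<subseteq> Rg 1" "is_subalgebra \<iota> hull S = UNIV"
    using R by (auto simp: standard_graded_algebra_def)
  obtain x where x: "bij_betw x {0..<card S} S" using ex_bij_betw_nat_finite[OF S(1)] by blast
  define r where "r = card S"
  interpret vector_space "\<lambda>c. (*) (\<iota> c)"
    by (rule vector_space_via_ring_hom[OF standard_graded_algebraD(1)[OF R] module_ring])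
  define A where "A = span (range (monomial x r))"
  have mon: "monomial x r a \<in> A" for a unfolding A_def by (intro span_base) simp
  have A: "subspace A" by (simp add: A_def subspace_span)
  have mult_mon: "monomial x r a * y \<in> A" if "y \<in> A" for a y
    using that unfolding A_def
  proof (induction rule: span_induct)
    case base
    show "subspace {y. monomial x r a * y \<in> span (range (monomial x r))}"
      unfolding A_def[symmetric]
      by (rule subspaceI)
        (use subspace_0[OF A] subspace_add[OF A] subspace_scale[OF A] in \<open>auto simp: distrib_left mult.left_commute[of "monomial x r a" "\<iota> c" for c]\<close>)
  next
    case (step y)
    then obtain b where "y = monomial x r b" by blast
    thus ?case using mon by (simp add: A_def monomial_mult)
  qed
  have mult: "z * y \<in> A" if "z \<in> A" "y \<in> A" for z y
    using that(1) unfolding A_def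
  proof (induction rule: span_induct)
    case base
    show "subspace {z. z * y \<in> span (range (monomial x r))}"
      unfolding A_def[symmetric]
      by (rule subspaceI)
        (use subspace_0[OF A] subspace_add[OF A] subspace_scale[OF A] in \<open>auto simp: distrib_right mult.assoc\<close>)
  next
    case (step z)
    then obtain b where "z = monomial x r b" by blast
    thus ?case using mult_mon[OF that(2)] by (simp add: A_def)
  qed
  have "is_subalgebra \<iota> A" unfolding is_subalgebra_def
  proof (intro conjI ballI subsetI)
    fix z assume "z \<in> range \<iota>"
    then obtain c where "z = \<iota> c * 1" by auto
    moreover have "monomial x r (\<lambda>_. 0) = 1" by (simp add: monomial_def)
    ultimately show "z \<in> A" using subspace_scale[OF A mon, of c "\<lambda>_. 0"] by simp
  qed (use mult subspace_add[OF A] in auto)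
  moreover have "S \<subseteq> A"
  proof
    fix z assume "z \<in> S"
    then obtain l where l: "l < r" "z = x l" using x
      by (force simp: bij_betw_def r_def)
    have "monomial x r (\<lambda>k. if k = l then 1 else 0) = (\<Prod>k<r. if k = l then x l else 1)"
      unfolding monomial_def by (intro prod.cong) auto
    also have "\<dots> = x l" using l by (simp add: prod.delta)
    finally show "z \<in> A" using mon l by metis
  qed
  ultimately have "UNIV \<subseteq> A" using hull_minimal[of S A "is_subalgebra \<iota>"] S(3) by simp
  hence "y \<in> span (range (monomial x r))" for y unfolding A_def by blast
  moreover have "x l \<in> Rg 1" if "l < r" for l
    using x S(2) that by (auto simp: bij_betw_def r_def)
  ultimately show ?thesis using that by blast
qed

text \<open>
  The components of any finite generating set generate as well.
\<close>

lemma homogeneous_generators: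
  fixes Mg :: "nat \<Rightarrow> 'm::ab_group_add set"
  assumes M: "graded_module Rg act Mg" and fg: "finitely_generated_module act"
  shows "\<exists>m (s::nat) e. (\<forall>i<s. m i \<in> Mg (e i)) \<and> module.span act (m ` {..<s}) = UNIV"
proof -
  interpret module act using M by (simp add: graded_module_def)
  have D: "direct_sum_decomposition Mg" using M by (simp add: graded_module_def)
  obtain S where S: "finite S" "span S = UNIV"
    using fg by (auto simp: finitely_generated_module_def)
  define T where "T = (\<Union>z\<in>S. component Mg z ` {j. component Mg z j \<noteq> 0})"
  have "finite T" unfolding T_def using S finite_component[OF D] by auto
  then obtain m where m: "bij_betw m {0..<card T} T" using ex_bij_betw_nat_finite by blast
  hence mT: "m ` {..<card T} = T" by (simp add: bij_betw_def lessThan_atLeast0)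
  have "\<exists>u. m i \<in> Mg u" if "i < card T" for i
  proof -
    have "m i \<in> T" using mT that by blast
    then obtain z j where "m i = component Mg z j" unfolding T_def by blast
    thus ?thesis using component_in[OF D] by metis
  qed
  then obtain e where e: "\<And>i. i < card T \<Longrightarrow> m i \<in> Mg (e i)" by metis
  have "S \<subseteq> span T"
  proof
    fix z assume "z \<in> S"
    hence "(\<Sum>j | component Mg z j \<noteq> 0. component Mg z j) \<in> span T"
      by (intro span_sum span_base) (auto simp: T_def)
    thus "z \<in> span T" by (simp add: sum_component[OF D])
  qed
  hence "span S \<subseteq> span T" by (intro span_minimal subspace_span)
  hence "span (m ` {..<card T}) = UNIV" using S(2) mT by auto
  thus ?thesis using e by (intro exI[of _ m] exI[of _ "card T"] exI[of _ e]) simp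
qed

text \<open>
  The terms, that is the monomials times homogeneous generators, span \<open>M\<close> over the field. As taking
  the component of degree \<open>j\<close> is linear and maps every term to itself or to 0, the terms of degree \<open>j\<close>
  span \<open>M\<^sub>j\<close>.
\<close>

lemma monomials_span_pieces:
  fixes \<iota> :: "'k::field \<Rightarrow> 'r::comm_ring_1" and act :: "'r \<Rightarrow> 'm::ab_group_add \<Rightarrow> 'm"
  assumes R: "standard_graded_algebra \<iota> Rg" and M: "graded_module Rg act Mg"
    and fg: "finitely_generated_module act"
  obtains x r m s e where "\<And>l. l < r \<Longrightarrow> x l \<in> Rg 1"
    "\<And>j. Mg j = module.span (\<lambda>c. act (\<iota> c))
        ((\<lambda>(i, a). act (monomial x r a) (m i)) ` graded_index s r e j)"
proof -
  obtain x r where x: "\<And>l. l < r \<Longrightarrow> x l \<in> Rg 1"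
    and Rspan: "\<And>y. y \<in> module.span (\<lambda>c. (*) (\<iota> c)) (range (monomial x r))"
    by (rule monomials_span_algebra[OF R]) blast
  obtain m e and s :: nat where m: "\<And>i. i < s \<Longrightarrow> m i \<in> Mg (e i)"
    and Mspan: "module.span act (m ` {..<s}) = UNIV"
    using homogeneous_generators[OF M fg] by auto
  have mod: "module act" and D: "direct_sum_decomposition Mg"
    and act_deg: "\<And>i j a x. a \<in> Rg i \<Longrightarrow> x \<in> Mg j \<Longrightarrow> act a x \<in> Mg (i + j)"
    using M by (auto simp: graded_module_def)
  interpret A: module act by (rule mod)
  interpret R: vector_space "\<lambda>c. (*) (\<iota> c)"
    by (rule vector_space_via_ring_hom[OF standard_graded_algebraD(1)[OF R] module_ring])
  interpret K: vector_space "\<lambda>c. act (\<iota> c)"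
    by (rule vector_space_via_ring_hom[OF standard_graded_algebraD(1)[OF R] mod])
  define v where "v = (\<lambda>(i, a). act (monomial x r a) (m i))"
  have v_deg: "v (i, a) \<in> Mg ((\<Sum>l<r. a l) + e i)" if "i < s" for i a
    unfolding v_def using act_deg[OF monomial_in_degree[OF R x] m[OF that]] by simp
  define U where "U = K.span (v ` ({..<s} \<times> UNIV))"
  have U: "K.subspace U" by (simp add: U_def K.subspace_span)
  have vU: "v (i, a) \<in> U" if "i < s" for i a unfolding U_def using that by (intro K.span_base) simp
  have mon_U: "act (monomial x r b) u \<in> U" if "u \<in> U" for b u
    using that unfolding U_def
  proof (induction rule: K.span_induct)
    case base
    show "K.subspace {u. act (monomial x r b) u \<in> K.span (v ` ({..<s} \<times> UNIV))}"
      unfolding U_def[symmetric]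
      by (rule K.subspaceI)
        (use K.subspace_0[OF U] K.subspace_add[OF U] K.subspace_scale[OF U]
          in \<open>auto simp: A.scale_right_distrib A.scale_left_commute[of "monomial x r b" "\<iota> k" for k]
            simp del: A.scale_scale\<close>)
  next
    case (step u)
    then obtain i a where u: "i < s" "u = v (i, a)" by auto
    have "act (monomial x r b) u = v (i, \<lambda>l. b l + a l)"
      by (simp add: u v_def monomial_mult)
    thus ?case using vU[OF u(1)] by (simp add: U_def)
  qed
  have act_U: "act y u \<in> U" if u: "u \<in> U" for y u
    using Rspan[of y]
  proof (induction rule: R.span_induct)
    case base
    show "R.subspace {y. act y u \<in> U}"
      by (rule R.subspaceI)
        (use K.subspace_0[OF U] K.subspace_add[OF U] K.subspace_scale[OF U]
          in \<open>auto simp: A.scale_left_distrib A.scale_scale[symmetric] simp del: A.scale_scale\<close>)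
  next
    case (step y) thus ?case using mon_U[OF u] by blast
  qed
  have "A.subspace U"
    by (rule A.subspaceI) (use act_U K.subspace_0[OF U] K.subspace_add[OF U] in auto)
  moreover have "m ` {..<s} \<subseteq> U"
  proof clarify
    fix i assume "i < s"
    moreover have "v (i, \<lambda>_. 0) = m i" by (simp add: v_def monomial_def)
    ultimately show "m i \<in> U" using vU by metis
  qed
  ultimately have "A.span (m ` {..<s}) \<subseteq> U" by (intro A.span_minimal)
  hence U_UNIV: "u \<in> U" for u using Mspan by blast
  have "Mg j = K.span (v ` graded_index s r e j)" (is "_ = K.span ?B") for j
  proof (rule antisym)
    have sub: "K.subspace (K.span ?B)" by (rule K.subspace_span)
    have "component Mg u j \<in> K.span ?B" for u
      using U_UNIV[of u] unfolding U_def
    proof (induction rule: K.span_induct)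
      case base
      have "component Mg (act (\<iota> c) u) j = act (\<iota> c) (component Mg u j)" for c u
      proof -
        have "\<iota> c \<in> Rg 0" using standard_graded_algebraD(3)[OF R] by simp
        hence deg: "act (\<iota> c) (component Mg u k) \<in> Mg k" for k
          using act_deg[OF _ component_in[OF D], of "\<iota> c" 0 u k] by simp
        have "act (\<iota> c) u = (\<Sum>k | component Mg u k \<noteq> 0. act (\<iota> c) (component Mg u k))"
          by (metis sum_component[OF D] A.scale_sum_right)
        hence "component Mg (act (\<iota> c) u) = (\<lambda>k. act (\<iota> c) (component Mg u k))"
          by (intro component_eqI[OF D deg finite_component[OF D]]) auto
        thus ?thesis by simp
      qed
      thus "K.subspace {u. component Mg u j \<in> K.span ?B}"
        by (intro K.subspaceI)
          (use K.subspace_0[OF sub] K.subspace_add[OF sub] K.subspace_scale[OF sub]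
            in \<open>auto simp: component_zero[OF D] component_add[OF D]\<close>)
    next
      case (step u)
      then obtain i a where u: "i < s" "u = v (i, a)" by auto
      \<comment> \<open>Exponents beyond the \<open>r\<close> variables do not affect the monomial, but must vanish in an index.\<close>
      define a' where "a' l = (if l < r then a l else 0)" for l
      have v': "v (i, a) = v (i, a')" by (simp add: v_def monomial_def a'_def)
      have "component Mg u j = (if j = (\<Sum>l<r. a l) + e i then u else 0)"
        using component_homogeneous[OF D v_deg[OF u(1)]] u(2) by simp
      moreover have "u \<in> ?B" if "j = (\<Sum>l<r. a l) + e i"
        using that u v' by (auto simp: graded_index_def exponents_def a'_def intro!: image_eqI[of _ v "(i, a')"])
      ultimately show ?case using K.span_base K.subspace_0[OF sub] by auto
    qed
    thus "Mg j \<subseteq> K.span ?B" using component_homogeneous[OF D] by (metis subsetI)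
    show "K.span ?B \<subseteq> Mg j"
    proof (rule K.span_minimal)
      show "?B \<subseteq> Mg j"
      proof clarify
        fix i a assume "(i, a) \<in> graded_index s r e j"
        hence "i < s" "(\<Sum>l<r. a l) + e i = j" by (auto simp: graded_index_def exponents_def)
        thus "v (i, a) \<in> Mg j" using v_deg by metis
      qed
      show "K.subspace (Mg j)"
      proof (rule K.subspaceI)
        fix c z assume "z \<in> Mg j"
        moreover have "\<iota> c \<in> Rg 0" using standard_graded_algebraD(3)[OF R] by simp
        ultimately show "act (\<iota> c) z \<in> Mg j" using act_deg[of "\<iota> c" 0 z j] by simp
      qed (auto intro: graded_zero[OF D] graded_add[OF D])
    qed
  qed
  hence *: "Mg j = K.span ((\<lambda>(i, a). act (monomial x r a) (m i)) ` graded_index s r e j)" for j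
    unfolding v_def .
  show ?thesis by (rule that[OF _ *]) (rule x)
qed

lemma hilbert_function_growth:
  fixes \<iota> :: "'k::field \<Rightarrow> 'r::comm_ring_1" and act :: "'r \<Rightarrow> 'm::ab_group_add \<Rightarrow> 'm"
  assumes R: "standard_graded_algebra \<iota> Rg" and M: "graded_module Rg act Mg"
    and fg: "finitely_generated_module act" and d: "d \<ge> 1"
  defines "H \<equiv> \<lambda>j. vector_space.dim (\<lambda>c. act (\<iota> c)) (Mg j)"
  shows "(\<exists>C. \<forall>j. real (H j) \<le> C * real (Suc j) ^ (d - 1)) \<or>
    (\<exists>c>0. \<exists>j0. \<forall>j\<ge>j0. c * real j ^ d \<le> real (H j))"
proof -
  have mod: "module act" using M by (simp add: graded_module_def)
  interpret A: module act by (rule mod)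
  interpret K: vector_space "\<lambda>c. act (\<iota> c)"
    by (rule vector_space_via_ring_hom[OF standard_graded_algebraD(1)[OF R] mod])
  obtain x r m s e where Mj: "\<And>j. Mg j = K.span
      ((\<lambda>(i, a). act (monomial x r a) (m i)) ` graded_index s r e j)"
    by (rule monomials_span_pieces[OF R M fg]) blast
  define v where "v = (\<lambda>(i, a). act (monomial x r a) (m i))"
  have "v (i, \<lambda>l. a l + c l) \<in> K.span (v ` (\<lambda>(k, b). (k, \<lambda>l. b l + c l)) ` X)"
    if "v (i, a) \<in> K.span (v ` X)" for i a c X
  proof -
    let ?Y = "K.span (v ` (\<lambda>(k, b). (k, \<lambda>l. b l + c l)) ` X)"
    have Y: "K.subspace ?Y" by (rule K.subspace_span)
    have shift: "act (monomial x r c) (v (k, b)) = v (k, \<lambda>l. b l + c l)" for k b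
      by (simp add: v_def monomial_mult add.commute)
    have "act (monomial x r c) (v (i, a)) \<in> ?Y"
      using that
    proof (induction rule: K.span_induct)
      case base
      show "K.subspace {u. act (monomial x r c) u \<in> ?Y}"
        by (rule K.subspaceI)
          (use K.subspace_0[OF Y] K.subspace_add[OF Y] K.subspace_scale[OF Y]
            in \<open>auto simp: A.scale_right_distrib A.scale_left_commute[of "monomial x r c" "\<iota> k" for k]
              simp del: A.scale_scale\<close>)
    next
      case (step u)
      then obtain k b where kb: "(k, b) \<in> X" "u = v (k, b)" by auto
      have "v (k, \<lambda>l. b l + c l) \<in> ?Y"
        using kb(1) by (intro K.span_base imageI image_eqI[of _ _ "(k, b)"]) auto
      thus ?case by (simp add: kb(2) shift)
    qed
    thus ?thesis by (simp only: shift)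
  qed
  from K.hilbert_function_dichotomy[OF d this, of s r e]
  show ?thesis by (simp add: H_def Mj v_def)
qed

section \<open>Lengths of the graded pieces modulo Frobenius powers\<close>

text \<open>
  A product of \<open>q\<close> elements of positive degree has degree at least \<open>q\<close>.
\<close>

lemma frobenius_power_subset_in_degrees_ge:
  assumes R: "standard_graded_algebra \<iota> Rg" and I: "I \<subseteq> in_degrees_ge Rg 1"
  shows "frobenius_power I q \<subseteq> in_degrees_ge Rg q"
proof -
  interpret module "(*) :: 'b \<Rightarrow> 'b \<Rightarrow> 'b" by (rule module_ring)
  note D = standard_graded_algebraD(2)[OF R]
  note act = in_degrees_ge_act[OF D standard_graded_algebraD(5)[OF R]]
  have pow: "z ^ n \<in> in_degrees_ge Rg n" if "z \<in> in_degrees_ge Rg 1" for z n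
  proof (induction n)
    case (Suc n) show ?case using act[OF that Suc] by simp
  qed (simp add: in_degrees_ge_0)
  have "subspace (in_degrees_ge Rg q)"
  proof (rule subspaceI)
    fix c z assume "z \<in> in_degrees_ge Rg q"
    thus "c * z \<in> in_degrees_ge Rg q" using act[of c 0 z q] by (simp add: in_degrees_ge_0)
  qed (auto intro: in_degrees_ge_zero[OF D] in_degrees_ge_add[OF D])
  moreover have "(\<lambda>x. x ^ q) ` I \<subseteq> in_degrees_ge Rg q" using pow I by blast
  ultimately show ?thesis unfolding frobenius_power_def by (intro span_minimal)
qed

lemma ideal_times_module_subset_in_degrees_ge:
  assumes R: "standard_graded_algebra \<iota> Rg" and M: "graded_module Rg act Mg"
    and J: "J \<subseteq> in_degrees_ge Rg q"
  shows "ideal_times_module act J \<subseteq> in_degrees_ge Mg q"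
proof -
  interpret module act using M by (simp add: graded_module_def)
  have D: "direct_sum_decomposition Mg" using M by (simp add: graded_module_def)
  note act = in_degrees_ge_act[OF standard_graded_algebraD(2)[OF R] M]
  have "subspace (in_degrees_ge Mg q)"
  proof (rule subspaceI)
    fix c z assume "z \<in> in_degrees_ge Mg q"
    thus "act c z \<in> in_degrees_ge Mg q" using act[of c 0 z q] by (simp add: in_degrees_ge_0)
  qed (auto intro: in_degrees_ge_zero[OF D] in_degrees_ge_add[OF D])
  moreover have "{act a x | a x. a \<in> J} \<subseteq> in_degrees_ge Mg q"
  proof clarify
    fix a x assume "a \<in> J"
    thus "act a x \<in> in_degrees_ge Mg q" using act[of a q x 0] J by (auto simp: in_degrees_ge_0)
  qed
  ultimately show ?thesis unfolding ideal_times_module_def by (intro span_minimal)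
qed

text \<open>
  By the pigeonhole principle, a monomial of degree greater than \<open>r t q\<close> in \<open>r\<close> variables has an
  exponent of at least \<open>t q\<close>, so it is a multiple of \<open>(x\<^sub>l ^ t) ^ q\<close>. If \<open>t\<close> is such that \<open>R\<^sub>t \<subseteq> I\<close>, this
  is in \<open>I\<^sup>[\<^sup>q\<^sup>]\<close>. The degrees of the generators of \<open>M\<close> only add a constant, absorbed in \<open>K\<close>.
\<close>

lemma pieces_vanish_in_high_degree:
  fixes \<iota> :: "'k::field \<Rightarrow> 'r::comm_ring_1" and act :: "'r \<Rightarrow> 'm::ab_group_add \<Rightarrow> 'm"
  assumes R: "standard_graded_algebra \<iota> Rg" and M: "graded_module Rg act Mg"
    and fg: "finitely_generated_module act"
    and I: "homogeneous_ideal Rg I" and fin: "finite_colength I"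
  shows "\<exists>K. \<forall>q\<ge>1. \<forall>j\<ge>K * q. Mg j \<subseteq> ideal_times_module act (frobenius_power I q)"
proof -
  have mod: "module act" using M by (simp add: graded_module_def)
  interpret A: module act by (rule mod)
  interpret R: module "(*) :: 'r \<Rightarrow> 'r \<Rightarrow> 'r" by (rule module_ring)
  interpret K: vector_space "\<lambda>c. act (\<iota> c)"
    by (rule vector_space_via_ring_hom[OF standard_graded_algebraD(1)[OF R] mod])
  obtain t where t: "Rg t \<subseteq> I" using finite_colength_contains_degree[OF R I fin] by blast
  obtain x r m s e where x: "\<And>l. l < r \<Longrightarrow> x l \<in> Rg 1"
    and Mj: "\<And>j. Mg j = K.span
      ((\<lambda>(i, a). act (monomial x r a) (m i)) ` graded_index s r e j)"
    by (rule monomials_span_pieces[OF R M fg]) (rule that)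
  define K where "K = r * t + (\<Sum>i<s. e i) + 1"
  have "Mg j \<subseteq> ideal_times_module act (frobenius_power I q)" if q: "q \<ge> 1" and j: "j \<ge> K * q" for q j
  proof -
    define N where "N = ideal_times_module act (frobenius_power I q)"
    have N: "A.subspace N" unfolding N_def ideal_times_module_def by (rule A.subspace_span)
    have "act (monomial x r a) (m i) \<in> N" if ia: "(i, a) \<in> graded_index s r e j" for i a
    proof -
      have i: "i < s" "e i \<le> j" and a: "(\<Sum>l<r. a l) = j - e i"
        using ia by (auto simp: graded_index_def exponents_def)
      have "\<exists>l<r. t * q \<le> a l"
      proof (rule ccontr)
        assume "\<not> ?thesis"
        hence "(\<Sum>l<r. a l) \<le> of_nat (card {..<r}) * (t * q)" by (intro sum_bounded_above) auto
        hence 1: "j \<le> r * t * q + e i" using a i by simp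
        have "e i \<le> (\<Sum>i<s. e i)" using i by (intro member_le_sum) auto
        hence "e i < ((\<Sum>i<s. e i) + 1) * 1" by simp
        also have "\<dots> \<le> ((\<Sum>i<s. e i) + 1) * q" using q by (intro mult_le_mono2)
        finally have "e i < ((\<Sum>i<s. e i) + 1) * q" .
        hence "r * t * q + e i < K * q" by (simp add: K_def algebra_simps)
        thus False using 1 j by simp
      qed
      then obtain l where l: "l < r" "t * q \<le> a l" by blast
      have xt: "x l ^ t \<in> Rg t"
      proof -
        have "monomial x r (\<lambda>k. if k = l then t else 0) = (\<Prod>k<r. if k = l then x l ^ t else 1)"
          unfolding monomial_def by (intro prod.cong) auto
        also have "\<dots> = x l ^ t" using l by (simp add: prod.delta)
        finally have "monomial x r (\<lambda>k. if k = l then t else 0) = x l ^ t" .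
        moreover have "(\<Sum>k<r. if k = l then t else 0) = t" using l by simp
        moreover have "monomial x r (\<lambda>k. if k = l then t else 0) \<in> Rg (\<Sum>k<r. if k = l then t else 0)"
          by (rule monomial_in_degree[OF R]) (rule x)
        ultimately show ?thesis by metis
      qed
      have "(x l ^ t) ^ q \<in> frobenius_power I q"
        unfolding frobenius_power_def using xt t by (intro R.span_base) blast
      moreover have "monomial x r a = (\<Prod>k\<in>{..<r} - {l}. x k ^ a k) * x l ^ (a l - t * q) * (x l ^ t) ^ q"
      proof -
        have "monomial x r a = x l ^ a l * (\<Prod>k\<in>{..<r} - {l}. x k ^ a k)"
          unfolding monomial_def using l by (intro prod.remove) auto
        also have "x l ^ a l = x l ^ (a l - t * q) * (x l ^ t) ^ q"
          using l by (simp add: power_mult[symmetric] power_add[symmetric])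
        finally show ?thesis by (simp only: mult_ac)
      qed
      ultimately have "monomial x r a \<in> frobenius_power I q"
        unfolding frobenius_power_def by (simp add: R.span_scale)
      thus ?thesis unfolding N_def ideal_times_module_def by (intro A.span_base) blast
    qed
    moreover have "K.subspace N"
      using A.subspace_0[OF N] A.subspace_add[OF N] A.subspace_scale[OF N]
      by (intro K.subspaceI) auto
    moreover have "(\<lambda>(i, a). act (monomial x r a) (m i)) ` graded_index s r e j \<subseteq> N"
      using calculation(1) by auto
    ultimately have "Mg j \<subseteq> N" unfolding Mj by (intro K.span_minimal)
    thus ?thesis by (simp add: N_def)
  qed
  thus ?thesis by blast
qed

text \<open>
  The length of the image of \<open>M\<^sub>u\<close> in \<open>M / N\<close>, for \<open>N = I\<^sup>[\<^sup>q\<^sup>] M\<close>, is at most the dimension of \<open>M\<^sub>u\<close>, with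
  equality if \<open>M\<^sub>u\<close> meets \<open>N\<close> only in 0. The latter holds for \<open>u < q\<close> if \<open>I\<close> is proper, since \<open>N\<close> then
  lives in degrees at least \<open>q\<close>.
\<close>

lemma hk_length_facts:
  fixes \<iota> :: "'k::field \<Rightarrow> 'r::comm_ring_1" and act :: "'r \<Rightarrow> 'm::ab_group_add \<Rightarrow> 'm"
  assumes R: "standard_graded_algebra \<iota> Rg" and M: "graded_module Rg act Mg"
    and fg: "finitely_generated_module act"
  defines "H \<equiv> \<lambda>j. vector_space.dim (\<lambda>c. act (\<iota> c)) (Mg j)"
  shows hk_length_neg: "j < 0 \<Longrightarrow> hk_length \<iota> act Mg I q j = 0"
    and hk_length_le_dim: "hk_length \<iota> act Mg I q (int u) \<le> H u"
    and hk_length_eq_0: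
      "Mg u \<subseteq> ideal_times_module act (frobenius_power I q) \<Longrightarrow> hk_length \<iota> act Mg I q (int u) = 0"
    and hk_length_eq_dim: "homogeneous_ideal Rg I \<Longrightarrow> I \<noteq> UNIV \<Longrightarrow> u < q \<Longrightarrow>
      hk_length \<iota> act Mg I q (int u) = H u"
proof -
  have mod: "module act" using M by (simp add: graded_module_def)
  interpret A: module act by (rule mod)
  interpret K: vector_space "\<lambda>c. act (\<iota> c)"
    by (rule vector_space_via_ring_hom[OF standard_graded_algebraD(1)[OF R] mod])
  have D: "direct_sum_decomposition Mg" using M by (simp add: graded_module_def)
  define N where "N = ideal_times_module act (frobenius_power I q)"
  define V where "V j = {x + y | x y. x \<in> piece Mg j \<and> y \<in> N}" for j
  have "A.subspace N" unfolding N_def ideal_times_module_def by (rule A.subspace_span)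
  hence N: "K.subspace N"
    using A.subspace_0 A.subspace_add A.subspace_scale by (intro K.subspaceI) auto
  have hk: "hk_length \<iota> act Mg I q j = the_enat (quotient_length (\<lambda>c. act (\<iota> c)) (V j) N)" for j
    by (simp add: hk_length_def N_def V_def Let_def)
  \<comment> \<open>Finiteness is recorded as well, because \<open>the_enat\<close> says nothing about an infinite length.\<close>
  have le: "hk_length \<iota> act Mg I q j \<le> card B" and ex: "quotient_length (\<lambda>c. act (\<iota> c)) (V j) N \<noteq> \<infinity>"
    if "finite B" "V j \<subseteq> K.span (N \<union> B)" for j B
  proof -
    have "quotient_length (\<lambda>c. act (\<iota> c)) (V j) N \<le> enat (card B)"
      by (rule K.quotient_length_le[OF that(1) N that(2)])
    thus "hk_length \<iota> act Mg I q j \<le> card B" "quotient_length (\<lambda>c. act (\<iota> c)) (V j) N \<noteq> \<infinity>"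
      unfolding hk by (cases "quotient_length (\<lambda>c. act (\<iota> c)) (V j) N"; simp)+
  qed
  have zero: "hk_length \<iota> act Mg I q j = 0" if "piece Mg j \<subseteq> N" for j
  proof -
    have "V j \<subseteq> N" unfolding V_def using that K.subspace_add[OF N] by blast
    hence "V j \<subseteq> K.span (N \<union> {})" using K.span_superset[of N] by simp
    from le[OF _ this] show ?thesis by simp
  qed
  show "hk_length \<iota> act Mg I q j = 0" if "j < 0" for j
    using that K.subspace_0[OF N] by (intro zero) (simp add: piece_def)
  show "Mg u \<subseteq> ideal_times_module act (frobenius_power I q) \<Longrightarrow> hk_length \<iota> act Mg I q (int u) = 0" for u
    by (intro zero) (simp add: piece_def N_def)
  obtain x r m s e where Mj: "\<And>j. Mg j = K.span
      ((\<lambda>(i, a). act (monomial x r a) (m i)) ` graded_index s r e j)"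
    by (rule monomials_span_pieces[OF R M fg]) blast
  have Msub: "K.subspace (Mg j)" for j unfolding Mj by (rule K.subspace_span)
  have basis: "\<exists>B. finite B \<and> B \<subseteq> Mg u \<and> K.independent B \<and> Mg u \<subseteq> K.span B \<and> card B = H u" for u
  proof -
    obtain B where B: "B \<subseteq> Mg u" "K.independent B" "Mg u \<subseteq> K.span B" "card B = H u"
      unfolding H_def by (rule K.basis_exists)
    moreover have "finite B"
      using K.independent_span_bound[OF finite_imageI[OF finite_graded_index] B(2)] B(1)
      unfolding Mj by blast
    ultimately show ?thesis by blast
  qed
  have V_span: "V (int u) \<subseteq> K.span (N \<union> B)" if "Mg u \<subseteq> K.span B" for u B
  proof -
    have "V (int u) \<subseteq> {x + y | x y. x \<in> K.span B \<and> y \<in> K.span N}"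
      unfolding V_def piece_def using that K.span_superset[of N] by auto
    thus ?thesis using K.span_Un[of B N] by (simp add: Un_commute)
  qed
  show "hk_length \<iota> act Mg I q (int u) \<le> H u" for u
    using basis[of u] le[OF _ V_span] by metis
  show "hk_length \<iota> act Mg I q (int u) = H u"
    if I: "homogeneous_ideal Rg I" "I \<noteq> UNIV" and u: "u < q" for u
  proof (rule antisym)
    obtain B where B: "finite B" "B \<subseteq> Mg u" "K.independent B" "Mg u \<subseteq> K.span B" "card B = H u"
      using basis by blast
    show "hk_length \<iota> act Mg I q (int u) \<le> H u" using le[OF B(1) V_span[OF B(4)]] B(5) by simp
    have "N \<subseteq> in_degrees_ge Mg q" unfolding N_def
      by (intro ideal_times_module_subset_in_degrees_ge[OF R M]
          frobenius_power_subset_in_degrees_ge[OF R] proper_homogeneous_ideal_positive[OF R I])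
    hence "z = 0" if "z \<in> Mg u" "z \<in> N" for z
      using component_homogeneous[OF D that(1), of u] that(2) u by (auto simp: in_degrees_ge_def)
    moreover have "K.span B \<subseteq> Mg u" using B(2) Msub by (rule K.span_minimal)
    ultimately have "K.span B \<inter> N \<subseteq> {0}" by blast
    moreover have "K.subspace (V (int u))"
      unfolding V_def piece_def using K.subspace_sums[OF Msub N] by simp
    moreover have "N \<subseteq> V (int u)"
    proof
      fix y assume "y \<in> N"
      moreover have "0 \<in> piece Mg (int u)" using K.subspace_0[OF Msub, of u] by (simp add: piece_def)
      moreover have "y = 0 + y" by simp
      ultimately show "y \<in> V (int u)" unfolding V_def by blast
    qed
    moreover have "B \<subseteq> V (int u)"
    proof
      fix y assume "y \<in> B"
      hence "y \<in> piece Mg (int u)" using B(2) by (auto simp: piece_def)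
      moreover have "y = y + 0" by simp
      ultimately show "y \<in> V (int u)" unfolding V_def using K.subspace_0[OF N] by blast
    qed
    ultimately have "enat (card B) \<le> quotient_length (\<lambda>c. act (\<iota> c)) (V (int u)) N"
      using B by (intro K.quotient_length_ge[OF N])
    thus "H u \<le> hk_length \<iota> act Mg I q (int u)"
      unfolding hk using ex[OF B(1) V_span[OF B(4)]] B(5)
      by (cases "quotient_length (\<lambda>c. act (\<iota> c)) (V (int u)) N") auto
  qed
qed

lemma hk_length_unit_ideal:
  assumes R: "standard_graded_algebra \<iota> Rg" and M: "graded_module Rg act Mg"
    and fg: "finitely_generated_module act"
  shows "hk_length \<iota> act Mg UNIV q j = 0"
proof (cases "j < 0")
  case True thus ?thesis by (rule hk_length_neg[OF R M fg])
next
  case False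
  interpret A: module act using M by (simp add: graded_module_def)
  interpret R: module "(*) :: 'b \<Rightarrow> 'b \<Rightarrow> 'b" by (rule module_ring)
  have "1 \<in> frobenius_power (UNIV :: 'b set) q"
    unfolding frobenius_power_def by (intro R.span_base) (metis power_one rangeI)
  hence "x \<in> ideal_times_module act (frobenius_power UNIV q)" for x
    unfolding ideal_times_module_def by (intro A.span_base) (use A.scale_one in force)
  hence "hk_length \<iota> act Mg UNIV q (int (nat j)) = 0"
    by (intro hk_length_eq_0[OF R M fg]) blast
  thus ?thesis using False by simp
qed

text \<open>
  The uniform support and the uniform bound of the approximations of the density. The bound comes from
  the convergence of the approximations at the single point \<open>1/p\<close>: for proper \<open>I\<close>, the lengths there
  are values of the Hilbert function of \<open>M\<close> at powers of \<open>p\<close>, which rules out growth of order \<open>j ^ d\<close>.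
\<close>

lemma hk_length_bounds:
  fixes \<iota> :: "'k::field \<Rightarrow> 'r::comm_ring_1" and act :: "'r \<Rightarrow> 'm::ab_group_add \<Rightarrow> 'm"
  assumes R: "standard_graded_algebra \<iota> Rg" and M: "graded_module Rg act Mg"
    and fg: "finitely_generated_module act"
    and I: "homogeneous_ideal Rg I" and fin: "finite_colength I"
    and d: "d \<ge> 1" and p: "p \<ge> 2"
    and density: "is_hk_density p d \<iota> act Mg I g"
  shows "\<exists>K C. \<forall>n j. (j < 0 \<or> int (K * p ^ n) \<le> j \<longrightarrow> hk_length \<iota> act Mg I (p ^ n) j = 0) \<and>
      (1 / real p ^ n) ^ (d - 1) * real (hk_length \<iota> act Mg I (p ^ n) j) \<le> C"
proof -
  define H where "H j = vector_space.dim (\<lambda>c. act (\<iota> c)) (Mg j)" for j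
  note facts = hk_length_facts[OF R M fg, folded H_def]
  obtain K where K: "\<And>q j. q \<ge> 1 \<Longrightarrow> j \<ge> K * q \<Longrightarrow>
      Mg j \<subseteq> ideal_times_module act (frobenius_power I q)"
    using pieces_vanish_in_high_degree[OF R M fg I fin] by blast
  have vanish: "hk_length \<iota> act Mg I (p ^ n) j = 0" if "j < 0 \<or> int (K * p ^ n) \<le> j" for n j
  proof (cases "j < 0")
    case True thus ?thesis by (rule facts(1))
  next
    case False
    hence "K * p ^ n \<le> nat j" using that by linarith
    hence "hk_length \<iota> act Mg I (p ^ n) (int (nat j)) = 0" using p by (intro facts(3) K) auto
    thus ?thesis using False by simp
  qed
  have "\<exists>C. \<forall>n j. (1 / real p ^ n) ^ (d - 1) * real (hk_length \<iota> act Mg I (p ^ n) j) \<le> C"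
  proof (cases "I = UNIV")
    case True
    thus ?thesis using hk_length_unit_ideal[OF R M fg] by (intro exI[of _ 0]) simp
  next
    case False
    have "\<not> (\<exists>c>0. \<exists>j0. \<forall>j\<ge>j0. c * real j ^ d \<le> real (H j))"
    proof
      assume "\<exists>c>0. \<exists>j0. \<forall>j\<ge>j0. c * real j ^ d \<le> real (H j)"
      then obtain c j0 where c: "c > 0" and j0: "\<And>j. j \<ge> j0 \<Longrightarrow> c * real j ^ d \<le> real (H j)" by blast
      define f where "f n = hk_seq p d \<iota> act Mg I n (1 / real p)" for n
      have "f \<longlonglongrightarrow> g (1 / real p)" using density unfolding is_hk_density_def f_def by blast
      hence "Bseq f" by (intro convergent_imp_Bseq convergentI)
      then obtain B where B: "\<And>n. norm (f n) \<le> B" unfolding Bseq_def by blast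
      \<comment> \<open>The approximation with index \<open>n + 1\<close> samples the Hilbert function at \<open>p ^ n < p ^ (n + 1)\<close>; it is at least \<open>b * p ^ n\<close>.\<close>
      define b where "b = c / real p ^ (d - 1)"
      have b: "b > 0" using c p by (simp add: b_def)
      have lower: "b * real p ^ n \<le> B" if n: "p ^ n \<ge> j0" for n
      proof -
        have "1 / real p * real p ^ Suc n = of_int (int (p ^ n))" using p by simp
        hence fl: "\<lfloor>1 / real p * real p ^ Suc n\<rfloor> = int (p ^ n)" by (simp only: floor_of_int)
        have lt: "p ^ n < p ^ Suc n" using p by simp
        have f: "f (Suc n) = (1 / real p ^ Suc n) ^ (d - 1) * real (H (p ^ n))"
          unfolding f_def hk_seq_def fl facts(4)[OF I False lt] by (rule refl)
        obtain d' where d': "d = Suc d'" using d by (cases d) auto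
        have "b * real p ^ n = (1 / real p ^ Suc n) ^ (d - 1) * (c * real (p ^ n) ^ d)"
          using p by (simp add: b_def d' field_simps power_mult_distrib)
        also have "\<dots> \<le> f (Suc n)" unfolding f using j0[OF n] by (intro mult_left_mono) auto
        also have "\<dots> \<le> B" using B[of "Suc n"] by simp
        finally show ?thesis .
      qed
      obtain n1 where n1: "B / b < real n1" using reals_Archimedean2 by blast
      define n where "n = max n1 j0"
      have n: "n < p ^ n" using p by (intro power_gt_expt) auto
      have "B < b * real n1" using n1 b by (simp add: field_simps)
      also have "\<dots> \<le> b * real (p ^ n)" using n b by (intro mult_left_mono of_nat_mono) (auto simp: n_def)
      also have "\<dots> \<le> B" using lower[of n] n by (simp add: n_def)
      finally show False by simp
    qed
    then obtain C where C: "\<And>j. real (H j) \<le> C * real (Suc j) ^ (d - 1)"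
      using hilbert_function_growth[OF R M fg d, folded H_def] by blast
    have C0: "C \<ge> 0" using C[of 0] by (simp add: order_trans[OF of_nat_0_le_iff])
    have "(1 / real p ^ n) ^ (d - 1) * real (hk_length \<iota> act Mg I (p ^ n) j) \<le> C * real K ^ (d - 1)" for n j
    proof (cases "j < 0 \<or> int (K * p ^ n) \<le> j")
      case True thus ?thesis using vanish C0 by simp
    next
      case False
      define u where "u = nat j"
      have "nat j < K * p ^ n" using False by linarith
      hence u: "j = int u" "Suc u \<le> K * p ^ n" using False by (simp_all add: u_def)
      have "real (hk_length \<iota> act Mg I (p ^ n) j) \<le> C * real (Suc u) ^ (d - 1)"
        unfolding u(1) using facts(2) C by (meson of_nat_mono order_trans)
      also have "\<dots> \<le> C * real (K * p ^ n) ^ (d - 1)"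
        using u(2) C0 by (intro mult_left_mono power_mono of_nat_mono) auto
      finally have "(1 / real p ^ n) ^ (d - 1) * real (hk_length \<iota> act Mg I (p ^ n) j) \<le>
          (1 / real p ^ n) ^ (d - 1) * (C * real (K * p ^ n) ^ (d - 1))"
        by (intro mult_left_mono) auto
      also have "\<dots> = C * real K ^ (d - 1)" using p by (simp add: power_mult_distrib field_simps)
      finally show ?thesis .
    qed
    thus ?thesis by blast
  qed
  thus ?thesis using vanish by blast
qed

section \<open>The Fourier transform of a limit of step functions\<close>

lemma floor_scaled_eq_iff:
  assumes "q > 0"
  shows "\<lfloor>x * real q\<rfloor> = j \<longleftrightarrow> x \<in> {real_of_int j / real q ..< (real_of_int j + 1) / real q}"
  using assms by (auto simp: floor_eq_iff field_simps)

lemma sampled_integral_eq_sum: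
  fixes c :: "int \<Rightarrow> complex"
  assumes q: "q > 0" and c: "\<And>j. j \<notin> {0..<N} \<Longrightarrow> c j = 0"
  shows "(LINT x|lebesgue. c \<lfloor>x * real q\<rfloor>) = (\<Sum>\<^sub>\<infinity>j. c j) / of_nat q"
    and "(\<lambda>x. c \<lfloor>x * real q\<rfloor>) \<in> borel_measurable lebesgue"
proof -
  define J where "J j = {real_of_int j / real q ..< (real_of_int j + 1) / real q}" for j
  have eq: "(\<lambda>x. c \<lfloor>x * real q\<rfloor>) = (\<lambda>x. \<Sum>j\<in>{0..<N}. indicat_real (J j) x *\<^sub>R c j)"
  proof
    fix x
    have "indicat_real (J j) x = (if j = \<lfloor>x * real q\<rfloor> then 1 else 0)" for j
      unfolding indicator_def J_def floor_scaled_eq_iff[OF q, symmetric] by (auto simp: of_bool_def)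
    hence "(\<Sum>j\<in>{0..<N}. indicat_real (J j) x *\<^sub>R c j) =
        (\<Sum>j\<in>{0..<N}. if j = \<lfloor>x * real q\<rfloor> then c j else 0)"
      by (intro sum.cong) simp_all
    also have "\<dots> = c \<lfloor>x * real q\<rfloor>" using c by (simp add: sum.delta')
    finally show "c \<lfloor>x * real q\<rfloor> = (\<Sum>j\<in>{0..<N}. indicat_real (J j) x *\<^sub>R c j)" ..
  qed
  have J_sets: "J j \<in> sets lebesgue" for j unfolding J_def by simp
  have J_measure: "measure lebesgue (J j) = 1 / real q" "emeasure lebesgue (J j) < \<infinity>" for j
  proof -
    have "real_of_int j / real q \<le> (real_of_int j + 1) / real q" using q by (simp add: divide_simps)
    hence "emeasure lebesgue (J j) = ennreal (1 / real q)"
      unfolding J_def using q by (simp add: diff_divide_distrib[symmetric])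
    thus "measure lebesgue (J j) = 1 / real q" "emeasure lebesgue (J j) < \<infinity>"
      by (simp_all add: measure_def)
  qed
  have int: "integrable lebesgue (\<lambda>x. indicat_real (J j) x *\<^sub>R c j)" for j
    using J_sets J_measure(2)[of j] by (intro integrable_scaleR_left integrable_real_indicator) auto
  show "(\<lambda>x. c \<lfloor>x * real q\<rfloor>) \<in> borel_measurable lebesgue"
    unfolding eq using int by (intro borel_measurable_sum borel_measurable_integrable)
  have "(LINT x|lebesgue. c \<lfloor>x * real q\<rfloor>) = (\<Sum>j\<in>{0..<N}. LINT x|lebesgue. indicat_real (J j) x *\<^sub>R c j)"
    unfolding eq by (intro Bochner_Integration.integral_sum int)
  also have "\<dots> = (\<Sum>j\<in>{0..<N}. (1 / real q) *\<^sub>R c j)"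
  proof (intro sum.cong refl)
    fix j
    have "integrable lebesgue (indicat_real (J j))"
      using J_sets J_measure(2)[of j] by (intro integrable_real_indicator) auto
    hence "(LINT x|lebesgue. indicat_real (J j) x *\<^sub>R c j) = (LINT x|lebesgue. indicat_real (J j) x) *\<^sub>R c j"
      by (intro integral_scaleR_left) auto
    also have "(LINT x|lebesgue. indicat_real (J j) x) = 1 / real q"
      using J_measure(1)[of j] by simp
    finally show "(LINT x|lebesgue. indicat_real (J j) x *\<^sub>R c j) = (1 / real q) *\<^sub>R c j" .
  qed
  also have "\<dots> = (\<Sum>j\<in>{0..<N}. c j) / of_nat q"
    by (simp add: scaleR_conv_of_real sum_divide_distrib)
  also have "(\<Sum>j\<in>{0..<N}. c j) = (\<Sum>\<^sub>\<infinity>j. c j)"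
    using c by (subst infsum_finite[symmetric], simp) (intro infsum_cong_neutral; auto)
  finally show "(LINT x|lebesgue. c \<lfloor>x * real q\<rfloor>) = (\<Sum>\<^sub>\<infinity>j. c j) / of_nat q" .
qed

lemma floor_scaled_tendsto:
  assumes p: "p \<ge> (2::nat)"
  shows "(\<lambda>n. real_of_int \<lfloor>x * real (p ^ n)\<rfloor> / real (p ^ n)) \<longlonglongrightarrow> x"
proof (rule real_tendsto_sandwich)
  have q: "real (p ^ n) > 0" for n using p by simp
  show "\<forall>\<^sub>F n in sequentially. x - (1 / real p) ^ n \<le> real_of_int \<lfloor>x * real (p ^ n)\<rfloor> / real (p ^ n)"
  proof (intro always_eventually allI)
    fix n
    have "x * real (p ^ n) - 1 \<le> real_of_int \<lfloor>x * real (p ^ n)\<rfloor>" by linarith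
    hence "(x * real (p ^ n) - 1) / real (p ^ n) \<le> real_of_int \<lfloor>x * real (p ^ n)\<rfloor> / real (p ^ n)"
      using q by (intro divide_right_mono) auto
    also have "(x * real (p ^ n) - 1) / real (p ^ n) = x - (1 / real p) ^ n"
      using p by (simp add: field_simps)
    finally show "x - (1 / real p) ^ n \<le> real_of_int \<lfloor>x * real (p ^ n)\<rfloor> / real (p ^ n)" .
  qed
  show "\<forall>\<^sub>F n in sequentially. real_of_int \<lfloor>x * real (p ^ n)\<rfloor> / real (p ^ n) \<le> x"
    using q by (intro always_eventually allI) (simp add: divide_le_eq of_int_floor_le del: of_nat_power)
  have "(\<lambda>n. (1 / real p) ^ n) \<longlonglongrightarrow> 0" using p by (intro LIMSEQ_power_zero) simp
  from tendsto_diff[OF tendsto_const this] show "(\<lambda>n. x - (1 / real p) ^ n) \<longlonglongrightarrow> x" by simp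
qed simp

text \<open>
  Sampling the exponential at \<open>\<lfloor>xq\<rfloor> / q\<close> instead of \<open>x\<close> makes the integral of the \<open>n\<close>-th step function
  equal to the \<open>n\<close>-th sum, and changes nothing in the limit. For complex \<open>y\<close> the exponential is
  unbounded on the real line, but on the common support \<open>[0, K]\<close> it is at most \<open>exp (|y| K)\<close>.
\<close>

lemma fourier_transform_as_limit:
  fixes len :: "nat \<Rightarrow> int \<Rightarrow> nat" and y :: complex
  assumes p: "p \<ge> 2" and d: "d \<ge> 1"
    and vanish: "\<And>n j. j < 0 \<or> int (K * p ^ n) \<le> j \<Longrightarrow> len n j = 0"
    and bound: "\<And>n j. (1 / real p ^ n) ^ (d - 1) * real (len n j) \<le> C"
    and lim: "\<And>x. (\<lambda>n. (1 / real p ^ n) ^ (d - 1) * real (len n \<lfloor>x * real p ^ n\<rfloor>)) \<longlonglongrightarrow> g x"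
  shows "(\<lambda>n. (1 / of_nat p ^ n) ^ d *
      (\<Sum>\<^sub>\<infinity>j::int. of_nat (len n j) * exp (- \<i> * y * of_int j / of_nat p ^ n))) \<longlonglongrightarrow> holomorphic_fourier g y"
proof -
  define a where "a n j = (1 / real p ^ n) ^ (d - 1) * real (len n j)" for n j
  define E where "E t = exp (- \<i> * y * of_real t)" for t
  define c where "c n j = of_real (a n j) * E (real_of_int j / real (p ^ n))" for n j
  define s where "s n x = c n \<lfloor>x * real (p ^ n)\<rfloor>" for n x
  have q: "p ^ n > 0" for n using p by simp
  have c0: "c n j = 0" if "j \<notin> {0..<int (K * p ^ n)}" for n j
    using vanish[of j n] that by (auto simp: c_def a_def)
  have s_meas: "s n \<in> borel_measurable lebesgue" for n
    unfolding s_def by (rule sampled_integral_eq_sum(2)[OF q c0])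
  have s_lim: "(\<lambda>n. s n x) \<longlonglongrightarrow> of_real (g x) * E x" for x
  proof -
    have "(\<lambda>n. a n \<lfloor>x * real (p ^ n)\<rfloor>) \<longlonglongrightarrow> g x"
      using lim[of x] by (simp add: a_def)
    moreover have "(\<lambda>n. E (real_of_int \<lfloor>x * real (p ^ n)\<rfloor> / real (p ^ n))) \<longlonglongrightarrow> E x"
      unfolding E_def by (intro tendsto_intros floor_scaled_tendsto[OF p])
    ultimately show ?thesis unfolding s_def c_def by (intro tendsto_mult tendsto_of_real)
  qed
  have C0: "C \<ge> 0" using order_trans[OF _ bound[of 0 0]] by simp
  define w where "w x = C * exp (norm y * real K) * indicator {0..real K} x" for x :: real
  have s_bound: "norm (s n x) \<le> w x" for n x
  proof (cases "x \<in> {0..real K}")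
    case True
    define t where "t = real_of_int \<lfloor>x * real (p ^ n)\<rfloor> / real (p ^ n)"
    have "t \<ge> 0" using True q[of n] unfolding t_def by (intro divide_nonneg_nonneg) auto
    moreover have "t \<le> x"
      unfolding t_def using q[of n] by (simp add: divide_le_eq of_int_floor_le del: of_nat_power)
    ultimately have t: "\<bar>t\<bar> \<le> real K" using True by simp
    have "norm (E t) \<le> exp (norm (- \<i> * y * of_real t))" unfolding E_def by (rule norm_exp)
    also have "\<dots> \<le> exp (norm y * real K)"
      using t by (simp add: norm_mult mult_left_mono)
    finally have "norm (E t) \<le> exp (norm y * real K)" .
    moreover have "norm (of_real (a n j) :: complex) \<le> C" for j
    proof -
      have "a n j \<ge> 0" by (simp add: a_def)
      thus ?thesis using bound[of n j, folded a_def] by (simp only: norm_of_real abs_of_nonneg)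
    qed
    ultimately show ?thesis
      unfolding s_def c_def w_def t_def[symmetric] norm_mult using True C0
      by (auto intro!: mult_mono)
  next
    case False
    have "\<lfloor>x * real (p ^ n)\<rfloor> \<notin> {0..<int (K * p ^ n)}"
    proof (cases "x < 0")
      case True
      hence "x * real (p ^ n) < 0" using q[of n] by (intro mult_neg_pos) auto
      thus ?thesis by (simp del: of_nat_power)
    next
      case F: False
      hence "real K * real (p ^ n) \<le> x * real (p ^ n)" using False by (intro mult_right_mono) auto
      hence "int (K * p ^ n) \<le> \<lfloor>x * real (p ^ n)\<rfloor>" by (simp add: le_floor_iff)
      thus ?thesis by simp
    qed
    thus ?thesis using c0 C0 by (simp add: s_def w_def)
  qed
  have w_int: "integrable lebesgue w"
    unfolding w_def by (intro integrable_mult_right integrable_real_indicator) auto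
  have "(\<lambda>n. integral\<^sup>L lebesgue (s n)) \<longlonglongrightarrow> (LINT x|lebesgue. of_real (g x) * E x)"
  proof (rule integral_dominated_convergence[OF _ s_meas w_int])
    show "(\<lambda>x. of_real (g x) * E x) \<in> borel_measurable lebesgue"
      by (rule borel_measurable_LIMSEQ_metric[OF s_meas s_lim])
  qed (use s_lim s_bound in auto)
  moreover have "integral\<^sup>L lebesgue (s n) = (1 / of_nat p ^ n) ^ d *
      (\<Sum>\<^sub>\<infinity>j::int. of_nat (len n j) * exp (- \<i> * y * of_int j / of_nat p ^ n))" for n
  proof -
    have "integral\<^sup>L lebesgue (s n) = (\<Sum>\<^sub>\<infinity>j. c n j) / of_nat (p ^ n)"
      unfolding s_def by (rule sampled_integral_eq_sum(1)[OF q c0])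
    also have "(\<Sum>\<^sub>\<infinity>j. c n j) = (\<Sum>\<^sub>\<infinity>j. (1 / of_nat p ^ n) ^ (d - 1) *
        (of_nat (len n j) * exp (- \<i> * y * of_int j / of_nat p ^ n)))"
      by (intro infsum_cong) (simp add: c_def a_def E_def)
    also have "\<dots> = (1 / of_nat p ^ n) ^ (d - 1) *
        (\<Sum>\<^sub>\<infinity>j. of_nat (len n j) * exp (- \<i> * y * of_int j / of_nat p ^ n))"
      by (rule infsum_cmult_right')
    also have "\<dots> / of_nat (p ^ n) = (1 / of_nat p ^ n) ^ d *
        (\<Sum>\<^sub>\<infinity>j. of_nat (len n j) * exp (- \<i> * y * of_int j / of_nat p ^ n))"
      using d by (cases d) auto
    finally show ?thesis .
  qed
  ultimately show ?thesis by (simp add: holomorphic_fourier_def E_def)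
qed

theorem proposition4p9:
  fixes \<iota> :: "'k::field \<Rightarrow> 'r::comm_ring_1"
    and Rg :: "nat \<Rightarrow> 'r set"
    and I :: "'r set"
    and act :: "'r \<Rightarrow> 'm::ab_group_add \<Rightarrow> 'm"
    and Mg :: "nat \<Rightarrow> 'm set"
    and p d :: nat
    and g :: "real \<Rightarrow> real"
  assumes "CHAR('k) = p" and "p > 0"
    and "standard_graded_algebra \<iota> Rg"
    and "krull_dim TYPE('r) = enat d" and "d \<ge> 1"
    and "homogeneous_ideal Rg I" and "finite_colength I"
    and "graded_module Rg act Mg" and "finitely_generated_module act"
    and "is_hk_density p d \<iota> act Mg I g"
  shows "\<forall>y::complex. holomorphic_fourier g y = frobenius_poincare p d \<iota> act Mg I y"
proof
  fix y :: complex
  \<comment> \<open>A field has \<open>1 \<noteq> 0\<close>. That \<open>p \<ge> 2\<close> is what makes \<open>p ^ n\<close> tend to infinity.\<close>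
  have "p \<noteq> 1" using \<open>CHAR('k) = p\<close> of_nat_CHAR[where 'a = 'k] by auto
  hence p: "p \<ge> 2" using \<open>p > 0\<close> by simp
  obtain K C where
    vanish: "\<And>n j. j < 0 \<or> int (K * p ^ n) \<le> j \<Longrightarrow> hk_length \<iota> act Mg I (p ^ n) j = 0" and
    bound: "\<And>n j. (1 / real p ^ n) ^ (d - 1) * real (hk_length \<iota> act Mg I (p ^ n) j) \<le> C"
    using hk_length_bounds[OF assms(3,8,9,6,7,5) p assms(10)] by blast
  have lim: "(\<lambda>n. (1 / real p ^ n) ^ (d - 1) *
      real (hk_length \<iota> act Mg I (p ^ n) \<lfloor>x * real p ^ n\<rfloor>)) \<longlonglongrightarrow> g x" for x
    using assms(10) by (simp add: is_hk_density_def hk_seq_def)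
  have "(\<lambda>n. (1 / of_nat p ^ n) ^ d * (\<Sum>\<^sub>\<infinity>j::int. of_nat (hk_length \<iota> act Mg I (p ^ n) j) *
      exp (- \<i> * y * of_int j / of_nat p ^ n))) \<longlonglongrightarrow> holomorphic_fourier g y"
    by (rule fourier_transform_as_limit[where len = "\<lambda>n. hk_length \<iota> act Mg I (p ^ n)",
        OF p assms(5) vanish bound lim])
  thus "holomorphic_fourier g y = frobenius_poincare p d \<iota> act Mg I y"
    unfolding frobenius_poincare_def by (rule limI[symmetric])
qed

end
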